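(* There exists an oracle $A$ with multilinear extension $\widetilde{A}$ such that \[ \mathrm{pr}\text{-}\mathsf{PostBPE}^{\widetilde{A}} \subseteq \text{i.o.-}\mathsf{SIZE}^{A}[O(n)]. \] In particular, this oracle also satisfies $\mathrm{pr}\text{-}\mathsf{MA}_{\mathsf{E}}^{\widetilde{A}} \subseteq \text{i.o.-}\mathsf{SIZE}^{A}[O(n)]$.
   Context: An oracle $A$ is a family of Boolean functions $A_m:\{0,1\}^m\to\{0,1\}$, one for each $m\in\mathbb{N}$. For a finite field $\mathbb{F}$, $\widetilde{A}_{m,\mathbb{F}}:\mathbb{F}^m\to\mathbb{F}$ is the unique multilinear polynomial over $\mathbb{F}$ agreeing with $A_m$ on $\{0,1\}^m$. The multilinear extension $\widetilde{A}$ is the collection of all $\widetilde{A}_{m,\mathbb{F}}$. A machine with access to $\widetilde{A}$ may query any $\widetilde{A}_{m,\mathbb{F}}$ of its choice, each query costing time $O(m\log|\mathbb{F}|)$. $\mathrm{pr}\text{-}\mathsf{PostBPE}^{\widetilde{A}}$ is the class of promise problems $\Pi=(\Pi_{\rm yes},\Pi_{\rm no})$ for which there are two $2^{O(n)}$-time algorithms $D,B$ with oracle access to $\widetilde{A}$, taking input $x$ and the same random string $r$, such that for every $x\in\Pi_{\rm yes}\cup\Pi_{\rm no}$: $\Pr_r[B(x,r)=1]>0$; if $x\in\Pi_{\rm yes}$ then $\Pr_r[D(x,r)=1\mid B(x,r)=1]\ge 2/3$; and if $x\in\Pi_{\rm no}$ then $\Pr_r[D(x,r)=1\mid B(x,r)=1]\le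 1/3$. $\mathrm{pr}\text{-}\mathsf{MA}_{\mathsf{E}}^{\widetilde{A}}$ is the class of promise problems for which there is a $2^{O(n)}$-time randomized verifier $V$ with oracle access to $\widetilde{A}$, taking input $x$ and a proof $\pi$ (of length $2^{O(|x|)}$), such that: for yes-instances some $\pi$ gives $\Pr[V(x,\pi)=1]\ge 2/3$, and for no-instances every $\pi$ gives $\Pr[V(x,\pi)=1]\le 1/3$. A promise problem is in $\text{i.o.-}\mathsf{SIZE}^{A}[O(n)]$ if there is a constant $c$ such that, for infinitely many $n$, some circuit with $A$-oracle gates of size at most $cn$ agrees with the problem on every promise input of length $n$. *)

theory Defs
  imports
    "HOL-Probability.Probability"
    "HOL-Algebra.Polynomial_Divisibility"
    "HOL-Number_Theory.Residues"
begin

text \<open>An oracle; its restriction to lists of length \<open>m\<close> is the Boolean function \<open>A\<^sub>m\<close>.\<close>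

type_synonym bool_oracle = "bool list \<Rightarrow> bool"


section \<open>Multilinear extensions\<close>

definition field_points :: "('a, 'b) ring_scheme \<Rightarrow> nat \<Rightarrow> 'a list set" where
  "field_points F m = {z. length z = m \<and> set z \<subseteq> carrier F}"

definition multilinear :: "('a, 'b) ring_scheme \<Rightarrow> nat \<Rightarrow> ('a list \<Rightarrow> 'a) \<Rightarrow> bool" where
  "multilinear F m g \<longleftrightarrow>
     (\<exists>c \<in> Pow {..<m} \<rightarrow> carrier F. \<forall>z \<in> field_points F m.
        g z = finsum F (\<lambda>S. c S \<otimes>\<^bsub>F\<^esub> finprod F (\<lambda>i. z ! i) S) (Pow {..<m}))"

definition of_bit :: "('a, 'b) ring_scheme \<Rightarrow> bool \<Rightarrow> 'a" where
  "of_bit F b = (if b then \<one>\<^bsub>F\<^esub> else \<zero>\<^bsub>F\<^esub>)"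

definition is_mle :: "('a, 'b) ring_scheme \<Rightarrow> bool_oracle \<Rightarrow> nat \<Rightarrow> ('a list \<Rightarrow> 'a) \<Rightarrow> bool" where
  "is_mle F A m g \<longleftrightarrow>
     g \<in> extensional (field_points F m) \<and> multilinear F m g \<and>
     (\<forall>b. length b = m \<longrightarrow> g (map (of_bit F) b) = of_bit F (A b))"

text \<open>Existence and uniqueness are shown in \<open>is_mle_mle\<close> and \<open>mle_unique\<close> below.\<close>

definition mle :: "('a, 'b) ring_scheme \<Rightarrow> bool_oracle \<Rightarrow> nat \<Rightarrow> 'a list \<Rightarrow> 'a" where
  "mle F A m = (THE g. is_mle F A m g)"

context cring
begin

lemma monomial_of_bit:
  assumes "length b = m" "T \<subseteq> {..<m}"
  shows "finprod R (\<lambda>i. map (of_bit R) b ! i) T = (if T \<subseteq> {i. i < m \<and> b ! i} then \<one> else \<zero>)"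
proof -
  have "finite T" using assms(2) finite_subset by blast
  then show ?thesis using assms(2)
  proof (induction T rule: finite_induct)
    case empty
    then show ?case by simp
  next
    case (insert i T)
    have "finprod R (\<lambda>i. map (of_bit R) b ! i) (insert i T)
        = map (of_bit R) b ! i \<otimes> finprod R (\<lambda>i. map (of_bit R) b ! i) T"
      using insert assms(1) by (intro finprod_insert) (auto simp: of_bit_def)
    moreover have "map (of_bit R) b ! i = (if b ! i then \<one> else \<zero>)"
      using insert.prems assms(1) by (simp add: of_bit_def)
    ultimately show ?case using insert assms(1) by auto
  qed
qed

lemma multilinear_of_bit:
  assumes "length b = m" "c \<in> Pow {..<m} \<rightarrow> carrier R"
  shows "finsum R (\<lambda>S. c S \<otimes> finprod R (\<lambda>i. map (of_bit R) b ! i) S) (Pow {..<m})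
       = finsum R c (Pow {i. i < m \<and> b ! i})"
proof (rule add.finprod_mono_neutral_cong_right)
  show "finite (Pow {..<m})" by simp
  show "Pow {i. i < m \<and> b ! i} \<subseteq> Pow {..<m}" by auto
  show "c S \<otimes> finprod R (\<lambda>i. map (of_bit R) b ! i) S = c S"
    if "S \<in> Pow {i. i < m \<and> b ! i}" for S
  proof -
    have "S \<subseteq> {..<m}" "c S \<in> carrier R" using that assms(2) by (auto simp: Pi_def)
    then show ?thesis using that assms(1) by (simp add: monomial_of_bit)
  qed
qed (use assms in \<open>auto simp: monomial_of_bit Pi_def\<close>)

lemma moebius_exists:
  assumes "finite U" "h \<in> Pow U \<rightarrow> carrier R"
  shows "\<exists>c \<in> Pow U \<rightarrow> carrier R. \<forall>S \<subseteq> U. finsum R c (Pow S) = h S"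
  using assms
proof (induction U arbitrary: h rule: finite_induct)
  case empty
  then show ?case by (intro bexI[of _ h]) auto
next
  case (insert x U)
  obtain c where c: "c \<in> Pow U \<rightarrow> carrier R" "\<forall>S \<subseteq> U. finsum R c (Pow S) = h S"
  proof -
    have "h \<in> Pow U \<rightarrow> carrier R" using insert.prems by auto
    then show ?thesis using insert.IH[of h] that by blast
  qed
  obtain d where d: "d \<in> Pow U \<rightarrow> carrier R"
      "\<forall>S \<subseteq> U. finsum R d (Pow S) = h (insert x S) \<ominus> h S"
  proof -
    have "(\<lambda>S. h (insert x S) \<ominus> h S) \<in> Pow U \<rightarrow> carrier R"
    proof
      fix S assume "S \<in> Pow U"
      then have "h (insert x S) \<in> carrier R" "h S \<in> carrier R"
        by (blast intro: Pi_mem[OF insert.prems])+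
      then show "h (insert x S) \<ominus> h S \<in> carrier R" by (rule minus_closed)
    qed
    then show ?thesis using insert.IH[of "\<lambda>S. h (insert x S) \<ominus> h S"] that by blast
  qed
  define e where "e = (\<lambda>S. if x \<in> S then d (S - {x}) else c S)"
  have e: "e \<in> Pow (insert x U) \<rightarrow> carrier R"
  proof
    fix S assume S: "S \<in> Pow (insert x U)"
    show "e S \<in> carrier R"
    proof (cases "x \<in> S")
      case True
      have "S - {x} \<in> Pow U" using S by auto
      then show ?thesis using True Pi_mem[OF d(1)] by (simp add: e_def)
    next
      case False
      then have "S \<in> Pow U" using S by auto
      then show ?thesis using False Pi_mem[OF c(1)] by (simp add: e_def)
    qed
  qed
  have "finsum R e (Pow S) = h S" if S: "S \<subseteq> insert x U" for S
  proof -
    have lo: "finsum R e (Pow T) = h T" if "T \<subseteq> U" for T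
    proof -
      have "finsum R e (Pow T) = finsum R c (Pow T)"
        using that insert.hyps(2) c(1) by (intro add.finprod_cong') (auto simp: e_def)
      then show ?thesis using c(2) that by simp
    qed
    show ?thesis
    proof (cases "x \<in> S")
      case False
      then show ?thesis using S lo by auto
    next
      case True
      define T where "T = S - {x}"
      have T: "T \<subseteq> U" "S = insert x T" "x \<notin> T" "finite T"
        using S True insert.hyps(1) finite_subset by (auto simp: T_def)
      have inj: "inj_on (insert x) (Pow T)"
        using T(3) by (auto simp: inj_on_def)
      have "finsum R e (insert x ` Pow T) = finsum R (\<lambda>Z. e (insert x Z)) (Pow T)"
        using inj e T by (intro add.finprod_reindex) auto
      also have "\<dots> = finsum R d (Pow T)"
      proof (intro add.finprod_cong')
        fix Z assume "Z \<in> Pow T"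
        then have "x \<notin> Z" using T by auto
        then show "e (insert x Z) = d Z" by (simp add: e_def)
      qed (use d(1) T in auto)
      finally have hi: "finsum R e (insert x ` Pow T) = h S \<ominus> h T"
        using d(2) T by simp
      have "finsum R e (Pow S) = finsum R e (Pow T) \<oplus> finsum R e (insert x ` Pow T)"
      proof -
        have "e \<in> Pow T \<rightarrow> carrier R" "e \<in> insert x ` Pow T \<rightarrow> carrier R"
          by (rule Pi_anti_mono[THEN subsetD, OF _ e]; use T(1) in blast)+
        moreover have "Pow T \<inter> insert x ` Pow T = {}" using T(3) by auto
        ultimately show ?thesis
          using T(4) by (subst T(2), subst Pow_insert, intro finsum_Un_disjoint) auto
      qed
      also have "\<dots> = h T \<oplus> (h S \<ominus> h T)"
        using lo T hi by simp
      also have "\<dots> = h S"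
      proof -
        have "h S \<in> carrier R" "h T \<in> carrier R" using insert.prems T by auto
        then show ?thesis by algebra
      qed
      finally show ?thesis .
    qed
  qed
  then show ?case using e by blast
qed

lemma moebius_unique:
  assumes "finite U" "c \<in> Pow U \<rightarrow> carrier R" "d \<in> Pow U \<rightarrow> carrier R"
    and "\<And>S. S \<subseteq> U \<Longrightarrow> finsum R c (Pow S) = finsum R d (Pow S)"
    and "S \<subseteq> U"
  shows "c S = d S"
proof -
  have "finite S" using assms finite_subset by blast
  then show ?thesis using assms(5)
  proof (induction S rule: finite_psubset_induct)
    case (psubset S)
    have dec: "finsum R f (Pow S) = f S \<oplus> finsum R f (Pow S - {S})"
      if "f \<in> Pow U \<rightarrow> carrier R" for f
    proof -
      have "finsum R f (insert S (Pow S - {S})) = f S \<oplus> finsum R f (Pow S - {S})"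
        using that psubset by (intro finsum_insert) auto
      moreover have "insert S (Pow S - {S}) = Pow S" by auto
      ultimately show ?thesis by simp
    qed
    have "finsum R c (Pow S - {S}) = finsum R d (Pow S - {S})"
    proof (intro add.finprod_cong')
      show "d \<in> Pow S - {S} \<rightarrow> carrier R" using assms(3) psubset.prems by (auto simp: Pi_def)
    qed (use psubset in auto)
    moreover have "finsum R d (Pow S - {S}) \<in> carrier R"
      using assms(3) psubset.prems by (intro finsum_closed) (auto simp: Pi_def)
    moreover have "c S \<in> carrier R" "d S \<in> carrier R" using assms psubset by auto
    ultimately show ?case
      using dec[OF assms(2)] dec[OF assms(3)] assms(4)[OF psubset.prems] by simp
  qed
qed

lemma bits_of_subset:
  assumes "S \<subseteq> {..<m}"
  shows "{i. i < m \<and> map (\<lambda>i. i \<in> S) [0..<m] ! i} = S"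
  using assms by auto

lemma of_bit_points: "length b = m \<Longrightarrow> map (of_bit R) b \<in> field_points R m"
  by (auto simp: field_points_def of_bit_def)

lemma ex1_is_mle: "\<exists>!g. is_mle R A m g"
proof (rule ex_ex1I)
  define h where "h S = of_bit R (A (map (\<lambda>i. i \<in> S) [0..<m]))" for S
  have "h \<in> Pow {..<m} \<rightarrow> carrier R" by (auto simp: h_def of_bit_def)
  then obtain c where c: "c \<in> Pow {..<m} \<rightarrow> carrier R"
      "\<forall>S \<subseteq> {..<m}. finsum R c (Pow S) = h S"
    using moebius_exists[of "{..<m}" h] by auto
  define g where "g = restrict (\<lambda>z. finsum R (\<lambda>S. c S \<otimes> finprod R (\<lambda>i. z ! i) S) (Pow {..<m}))
      (field_points R m)"
  have "g (map (of_bit R) b) = of_bit R (A b)" if b: "length b = m" for b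
  proof -
    have "map (\<lambda>i. i \<in> {i. i < m \<and> b ! i}) [0..<m] = b"
      using b by (intro nth_equalityI) auto
    moreover have "{i. i < m \<and> b ! i} \<subseteq> {..<m}" by auto
    ultimately show ?thesis
      using c b of_bit_points[OF b] multilinear_of_bit[OF b c(1)] by (simp add: g_def h_def)
  qed
  moreover have "multilinear R m g"
    unfolding multilinear_def using c(1) by (intro bexI[of _ c]) (auto simp: g_def)
  ultimately show "\<exists>g. is_mle R A m g"
    by (intro exI[of _ g]) (auto simp: is_mle_def g_def)
next
  fix g g' assume a: "is_mle R A m g" "is_mle R A m g'"
  obtain c where c: "c \<in> Pow {..<m} \<rightarrow> carrier R" "\<forall>z \<in> field_points R m.
        g z = finsum R (\<lambda>S. c S \<otimes> finprod R (\<lambda>i. z ! i) S) (Pow {..<m})"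
    using a(1) by (auto simp: is_mle_def multilinear_def)
  obtain d where d: "d \<in> Pow {..<m} \<rightarrow> carrier R" "\<forall>z \<in> field_points R m.
        g' z = finsum R (\<lambda>S. d S \<otimes> finprod R (\<lambda>i. z ! i) S) (Pow {..<m})"
    using a(2) by (auto simp: is_mle_def multilinear_def)
  have eq: "finsum R c (Pow S) = finsum R d (Pow S)" if S: "S \<subseteq> {..<m}" for S
  proof -
    let ?b = "map (\<lambda>i. i \<in> S) [0..<m]"
    have len: "length ?b = m" by simp
    have "g (map (of_bit R) ?b) = g' (map (of_bit R) ?b)"
      using a len unfolding is_mle_def by metis
    then show ?thesis
      using c(2) d(2) of_bit_points[OF len] multilinear_of_bit[OF len c(1)]
        multilinear_of_bit[OF len d(1)] bits_of_subset[OF S] by metis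
  qed
  have cd: "c S = d S" if "S \<subseteq> {..<m}" for S
    using moebius_unique[OF _ c(1) d(1) eq that] by simp
  have "g z = g' z" if "z \<in> field_points R m" for z
  proof -
    have z: "z ! i \<in> carrier R" if "i < m" for i
      using \<open>z \<in> field_points R m\<close> that by (auto simp: field_points_def)
    have "finsum R (\<lambda>S. c S \<otimes> finprod R (\<lambda>i. z ! i) S) (Pow {..<m})
        = finsum R (\<lambda>S. d S \<otimes> finprod R (\<lambda>i. z ! i) S) (Pow {..<m})"
      using cd d(1) z by (intro add.finprod_cong') (auto intro!: m_closed finprod_closed)
    then show ?thesis using c(2) d(2) that by simp
  qed
  then show "g = g'"
    using a by (intro extensionalityI[of g "field_points R m" g']) (auto simp: is_mle_def)
qed

lemma is_mle_mle: "is_mle R A m (mle R A m)"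
  unfolding mle_def by (rule theI'[OF ex1_is_mle])

lemma mle_unique: "is_mle R A m g \<Longrightarrow> mle R A m = g"
  using ex1_is_mle is_mle_mle by blast

end


section \<open>Queries to the multilinear extension\<close>

text \<open>
  A query names a finite field as \<open>GF(p)[X]/(f)\<close>, with \<open>p\<close> prime and \<open>f\<close> irreducible over
  \<open>GF(p)\<close>; every finite field is of this form.  As in \<^theory>\<open>HOL-Algebra.Polynomials\<close>,
  coefficients are listed from the leading one downwards.  A field element is given by the
  coefficients, leading zeros included, of its representative of degree below \<open>degree f\<close>.
\<close>

definition presents_field :: "int \<Rightarrow> int list \<Rightarrow> bool" where
  "presents_field p f \<longleftrightarrow>
     Factorial_Ring.prime p \<and>
     f \<in> carrier (poly_ring (residue_ring p)) \<and>
     pirreducible\<^bsub>residue_ring p\<^esub> (carrier (residue_ring p)) f"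

definition presented_field :: "int \<Rightarrow> int list \<Rightarrow> int list set ring" where
  "presented_field p f = Rupt\<^bsub>residue_ring p\<^esub> (carrier (residue_ring p)) f"

definition field_elem :: "int \<Rightarrow> int list \<Rightarrow> int list \<Rightarrow> int list set" where
  "field_elem p f cs =
     ring.rupture_surj (residue_ring p) (carrier (residue_ring p)) f
       (ring.normalize (residue_ring p) cs)"

definition coeff_vectors :: "int \<Rightarrow> nat \<Rightarrow> int list set" where
  "coeff_vectors p k = {cs. length cs = k \<and> set cs \<subseteq> {0..<p}}"

text \<open>Well defined by \<open>bij_betw_field_elem\<close> below.\<close>

definition elem_coeffs :: "int \<Rightarrow> int list \<Rightarrow> int list set \<Rightarrow> int list" where
  "elem_coeffs p f a = (THE cs. cs \<in> coeff_vectors p (degree f) \<and> field_elem p f cs = a)"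

lemma field_residue_ring:
  assumes "Factorial_Ring.prime (p :: int)"
  shows "field (residue_ring p)" "carrier (residue_ring p) = {0..<p}" "\<zero>\<^bsub>residue_ring p\<^esub> = 0"
proof -
  interpret residues_prime "nat p" "residue_ring (int (nat p))"
    by unfold_locales (use assms in auto)
  have "int (nat p) = p" using prime_ge_0_int[OF assms] by simp
  then show "field (residue_ring p)" using is_field by simp
qed (auto simp: residue_ring_def)

lemma field_presented_field:
  assumes "presents_field p f"
  shows "field (presented_field p f)"
proof -
  have p: "Factorial_Ring.prime p" using assms by (simp add: presents_field_def)
  interpret R: field "residue_ring p" by (rule field_residue_ring[OF p])
  show ?thesis
    using assms R.rupture_is_field_iff_pirreducible[OF R.carrier_is_subfield]
    by (simp add: presents_field_def presented_field_def)
qed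

lemma bij_betw_field_elem:
  assumes "presents_field p f"
  shows "bij_betw (field_elem p f) (coeff_vectors p (degree f)) (carrier (presented_field p f))"
proof -
  have p: "Factorial_Ring.prime p" and f: "f \<in> carrier (poly_ring (residue_ring p))"
    using assms by (simp_all add: presents_field_def)
  interpret R: field "residue_ring p" by (rule field_residue_ring[OF p])
  let ?K = "carrier (residue_ring p)" and ?k = "degree f"
  define I where "I = (\<lambda>q. R.pmod q f) ` carrier (poly_ring (residue_ring p))"
  have "f \<noteq> []"
    using assms by (auto simp: presents_field_def ring_irreducible_def univ_poly_zero)
  then have I: "I = {q \<in> carrier (poly_ring (residue_ring p)). length q \<le> ?k}"
    unfolding I_def using R.pmod_image_characterization[OF R.carrier_is_subfield f] by simp
  have "bij_betw (R.rupture_surj ?K f) I (carrier (presented_field p f))"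
    unfolding bij_betw_def I_def presented_field_def
    using R.rupture_surj_inj_on[OF R.carrier_is_subfield f]
      R.rupture_carrier_as_pmod_image[OF R.carrier_is_subfield f] by simp
  moreover have "bij_betw R.normalize (coeff_vectors p ?k) I"
  proof (rule bij_betw_byWitness[where f' = "\<lambda>q. replicate (?k - length q) 0 @ q"])
    show "\<forall>cs \<in> coeff_vectors p ?k.
        replicate (?k - length (R.normalize cs)) 0 @ R.normalize cs = cs"
      using R.normalize_def' field_residue_ring(3)[OF p]
      by (metis (mono_tags, lifting) coeff_vectors_def mem_Collect_eq)
    have norm: "R.normalize q = q" if "q \<in> I" for q
      using that I R.normalize_polynomial[of ?K q] by (simp add: univ_poly_def)
    show "\<forall>q \<in> I. R.normalize (replicate (?k - length q) 0 @ q) = q"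
      using norm R.normalize_replicate_zero field_residue_ring(3)[OF p] by metis
    show "R.normalize ` coeff_vectors p ?k \<subseteq> I"
      using R.normalize_gives_polynomial[of _ ?K] field_residue_ring(2)[OF p]
      by (auto simp: coeff_vectors_def I univ_poly_def intro: order.trans[OF R.normalize_length_le])
    show "(\<lambda>q. replicate (?k - length q) 0 @ q) ` I \<subseteq> coeff_vectors p ?k"
    proof safe
      fix q assume "q \<in> I"
      then have "set q \<subseteq> {0..<p}" "length q \<le> ?k"
        using R.polynomial_incl[of ?K q] field_residue_ring(2)[OF p] by (simp_all add: I univ_poly_def)
      then show "replicate (?k - length q) 0 @ q \<in> coeff_vectors p ?k"
        using prime_gt_0_int[OF p] by (auto simp: coeff_vectors_def)
    qed
  qed
  ultimately show ?thesis
    using bij_betw_trans[of R.normalize] by (simp add: field_elem_def [abs_def] comp_def)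
qed

datatype sym = Blank | Sep | Bit bool

text \<open>The maximal \<open>Sep\<close>-free blocks of a word, always at least one.\<close>

fun blocks :: "sym list \<Rightarrow> bool list list" where
  "blocks [] = [[]]"
| "blocks (Bit b # w) = (b # hd (blocks w)) # tl (blocks w)"
| "blocks (Sep # w) = [] # blocks w"
| "blocks (Blank # w) = blocks w"

abbreviation bits_to_int :: "bool list \<Rightarrow> int" where
  "bits_to_int bs \<equiv> horner_sum of_bool 2 bs"

definition int_to_bits :: "nat \<Rightarrow> int \<Rightarrow> bool list" where
  "int_to_bits w c = map (bit c) [0..<w]"

fun chunks :: "nat \<Rightarrow> nat \<Rightarrow> 'a list \<Rightarrow> 'a list list" where
  "chunks k 0 xs = []"
| "chunks k (Suc m) xs = take k xs # chunks k m (drop k xs)"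

text \<open>
  A query word has the form \<open>p # f\<^sub>k # \<dots> # f\<^sub>0 # # c\<^sub>1 # \<dots> # c\<^sub>m\<^sub>k\<close> (with \<open>#\<close> for \<open>Sep\<close>), where
  the \<open>c\<^sub>j\<close> are the concatenated coefficients of the \<open>m\<close> coordinates of the point, so that the
  empty block marks the end of \<open>f\<close>; for \<open>m = 0\<close> the word ends in \<open># #\<close>.  All numbers are in
  binary, least significant bit first, and as long as the block for \<open>p\<close>.  Writing down a query
  at a point of \<open>F^m\<close> thus takes \<open>\<Theta>((m + 1) log |F|)\<close> symbols if \<open>p\<close> has no leading
  zeros.  The value is returned in the same format; words of any other form are answered
  by the empty word.
\<close>

definition query_reply :: "bool_oracle \<Rightarrow> sym list \<Rightarrow> sym list" where
  "query_reply A q =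
    (let bp = hd (blocks q);
         bf = takeWhile (\<lambda>b. b \<noteq> []) (tl (blocks q));
         bz = tl (dropWhile (\<lambda>b. b \<noteq> []) (tl (blocks q)));
         w = length bp;
         p = bits_to_int bp;
         f = map bits_to_int bf;
         cs = map bits_to_int bz;
         k = degree f;
         m = length cs div k
     in if (\<forall>b \<in> set (bf @ bz). length b = w) \<and> presents_field p f \<and>
           k dvd length cs \<and> set cs \<subseteq> {0..<p}
        then concat (map (\<lambda>c. map Bit (int_to_bits w c) @ [Sep])
               (elem_coeffs p f
                  (mle (presented_field p f) A m (map (field_elem p f) (chunks k m cs)))))
        else [])"


section \<open>Oracle Turing machines\<close>

text \<open>
  A tape is infinite in both directions: \<open>(l, r)\<close> holds the cells to the left of the head, read
  leftwards, and the cells from the head on, read rightwards; all further cells are blank.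
\<close>

type_synonym tape = "sym list \<times> sym list"

datatype dir = Lft | Stay | Rgt

fun scan :: "tape \<Rightarrow> sym" where
  "scan (l, []) = Blank"
| "scan (l, s # r) = s"

fun write_sym :: "sym \<Rightarrow> tape \<Rightarrow> tape" where
  "write_sym s (l, r) = (l, s # tl r)"

fun move :: "dir \<Rightarrow> tape \<Rightarrow> tape" where
  "move Stay t = t"
| "move Rgt (l, r) = (scan (l, r) # l, tl r)"
| "move Lft ([], r) = ([], Blank # r)"
| "move Lft (s # l, r) = (l, s # r)"

datatype action =
    Halt bool
  | Query nat
  | Step nat "(sym \<times> dir) list"

text \<open>
  Machines are deterministic; randomness is an input.  States are natural numbers with initial
  state \<open>0\<close>, and a program is a finite transition table indexed by the state and the symbols
  scanned on all tapes (the first matching entry counts, a missing entry rejects).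
\<close>

datatype machine =
  Machine (work_tapes: nat) (program: "((nat \<times> sym list) \<times> action) list")

text \<open>
  Tape \<open>0\<close> is the query tape.  The query word extends from its head to the first blank.  The whole
  query tape is then replaced by the reply, so every query has to be written out anew and is
  charged its length by the steps spent on writing it.
\<close>

fun answer_query :: "bool_oracle \<Rightarrow> tape list \<Rightarrow> tape list" where
  "answer_query A [] = []"
| "answer_query A ((l, r) # ts) =
     ([], query_reply A (takeWhile (\<lambda>s. s \<noteq> Blank) r)) # ts"

text \<open>The outcome of a computation, if it halts within \<open>t\<close> steps.\<close>

fun exec :: "bool_oracle \<Rightarrow> machine \<Rightarrow> nat \<Rightarrow> nat \<times> tape list \<Rightarrow> bool option" where
  "exec A M 0 (q, ts) = None"
| "exec A M (Suc t) (q, ts) =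
     (case map_of (program M) (q, map scan ts) of
        None \<Rightarrow> Some False
      | Some (Halt b) \<Rightarrow> Some b
      | Some (Query q') \<Rightarrow> exec A M t (q', answer_query A ts)
      | Some (Step q' acts) \<Rightarrow>
          exec A M t (q', map2 (\<lambda>(s, d) tp. move d (write_sym s tp)) acts ts))"

definition start :: "machine \<Rightarrow> bool list list \<Rightarrow> nat \<times> tape list" where
  "start M inputs =
     (0, ([], []) # map (\<lambda>x. ([], map Bit x)) inputs @ replicate (work_tapes M) ([], []))"

definition halts_within :: "bool_oracle \<Rightarrow> machine \<Rightarrow> bool list list \<Rightarrow> nat \<Rightarrow> bool" where
  "halts_within A M inputs t \<longleftrightarrow> exec A M t (start M inputs) \<noteq> None"

definition accepts :: "bool_oracle \<Rightarrow> machine \<Rightarrow> bool list list \<Rightarrow> bool" where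
  "accepts A M inputs \<longleftrightarrow> (\<exists>t. exec A M t (start M inputs) = Some True)"


section \<open>Promise problems and complexity classes\<close>

text \<open>Pairs of yes-instances and no-instances.\<close>

type_synonym promise_problem = "bool list set \<times> bool list set"

text \<open>Bounds \<open>2\<^bsup>O(n)\<^esup>\<close>; the successor accounts for finitely many exceptions such as \<open>n = 0\<close>.\<close>

definition exp_bound :: "nat \<Rightarrow> nat \<Rightarrow> nat" where
  "exp_bound c n = 2 ^ (c * Suc n)"

definition coins :: "nat \<Rightarrow> bool list pmf" where
  "coins l = pmf_of_set {r. length r = l}"

definition pr_PostBPE :: "bool_oracle \<Rightarrow> promise_problem set" where
  "pr_PostBPE A = {(Yes, No). Yes \<inter> No = {} \<and>
     (\<exists>D B c d.
        (\<forall>x r. length r = exp_bound d (length x) \<longrightarrow>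
           halts_within A D [x, r] (exp_bound c (length x)) \<and>
           halts_within A B [x, r] (exp_bound c (length x))) \<and>
        (\<forall>x \<in> Yes \<union> No.
           \<P>(r in coins (exp_bound d (length x)). accepts A B [x, r]) > 0) \<and>
        (\<forall>x \<in> Yes.
           \<P>(r in coins (exp_bound d (length x)). accepts A D [x, r] \<bar> accepts A B [x, r]) \<ge> 2/3) \<and>
        (\<forall>x \<in> No.
           \<P>(r in coins (exp_bound d (length x)). accepts A D [x, r] \<bar> accepts A B [x, r]) \<le> 1/3))}"

definition pr_MA_E :: "bool_oracle \<Rightarrow> promise_problem set" where
  "pr_MA_E A = {(Yes, No). Yes \<inter> No = {} \<and>
     (\<exists>V c d e.
        (\<forall>x \<pi> r. length \<pi> \<le> exp_bound e (length x) \<longrightarrow> length r = exp_bound d (length x) \<longrightarrow>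
           halts_within A V [x, \<pi>, r] (exp_bound c (length x))) \<and>
        (\<forall>x \<in> Yes. \<exists>\<pi>. length \<pi> \<le> exp_bound e (length x) \<and>
           \<P>(r in coins (exp_bound d (length x)). accepts A V [x, \<pi>, r]) \<ge> 2/3) \<and>
        (\<forall>x \<in> No. \<forall>\<pi>. length \<pi> \<le> exp_bound e (length x) \<longrightarrow>
           \<P>(r in coins (exp_bound d (length x)). accepts A V [x, \<pi>, r]) \<le> 1/3))}"


section \<open>Circuits with oracle gates\<close>

text \<open>Wires \<open>0, \<dots>, n - 1\<close> carry the inputs, and wire \<open>n + j\<close> carries the value of gate \<open>j\<close>.\<close>

datatype gate =
    GConst bool
  | GNot nat
  | GAnd nat nat
  | GOr nat nat
  | GOracle "nat list"

fun gate_wires :: "gate \<Rightarrow> nat list" where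
  "gate_wires (GConst b) = []"
| "gate_wires (GNot i) = [i]"
| "gate_wires (GAnd i j) = [i, j]"
| "gate_wires (GOr i j) = [i, j]"
| "gate_wires (GOracle js) = js"

fun gate_val :: "bool_oracle \<Rightarrow> bool list \<Rightarrow> gate \<Rightarrow> bool" where
  "gate_val A v (GConst b) = b"
| "gate_val A v (GNot i) = (\<not> v ! i)"
| "gate_val A v (GAnd i j) = (v ! i \<and> v ! j)"
| "gate_val A v (GOr i j) = (v ! i \<or> v ! j)"
| "gate_val A v (GOracle js) = A (map ((!) v) js)"

datatype circuit = Circuit (gates: "gate list") (out_wire: nat)

definition circuit_on :: "nat \<Rightarrow> circuit \<Rightarrow> bool" where
  "circuit_on n C \<longleftrightarrow>
     (\<forall>j < length (gates C). \<forall>i \<in> set (gate_wires (gates C ! j)). i < n + j) \<and>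
     out_wire C < n + length (gates C)"

definition circuit_val :: "bool_oracle \<Rightarrow> circuit \<Rightarrow> bool list \<Rightarrow> bool" where
  "circuit_val A C x = foldl (\<lambda>v g. v @ [gate_val A v g]) x (gates C) ! out_wire C"

text \<open>Size counts gates and wires, so an oracle gate is charged its fan-in.\<close>

definition circuit_size :: "circuit \<Rightarrow> nat" where
  "circuit_size C = (\<Sum>g\<leftarrow>gates C. Suc (length (gate_wires g)))"

definition io_SIZE_linear :: "bool_oracle \<Rightarrow> promise_problem set" where
  "io_SIZE_linear A = {(Yes, No). Yes \<inter> No = {} \<and>
     (\<exists>c. \<exists>\<^sub>\<infinity>n. \<exists>C. circuit_on n C \<and> circuit_size C \<le> c * n \<and>
        (\<forall>x. length x = n \<longrightarrow>
           (x \<in> Yes \<longrightarrow> circuit_val A C x) \<and> (x \<in> No \<longrightarrow> \<not> circuit_val A C x)))}"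

end

theory Submission
  imports Defs
begin

text \<open>
  Fix an input length \<open>n\<close> and let \<open>A\<close> vary only on strings \<open>x @ w\<close> with \<open>|x| = n\<close> and
  \<open>|x @ w| = m = O(n)\<close>.  Regard \<open>A\<close> as a matrix with rows \<open>w\<close> and columns \<open>x\<close>; we want some row
  \<open>w\<close> to be the list of correct answers, so that \<open>x \<mapsto> A (x @ w)\<close> is a linear size circuit.
  The multilinear extension is additive in the columns, so a query over \<open>F\<close> is answered by one
  element of \<open>F\<close> per column.  Hence a computation with few queries splits the set of oracles into
  few combinatorial rectangles (products of sets of columns), whatever fields are queried.

  A rectangle that is not tiny contains, for every answer vector \<open>y\<close>, a fraction of at least
  \<open>(2J+4)\<close> to the power \<open>-2\<^sup>n\<close> of oracles having \<open>y\<close> among their rows, because in each column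
  almost all bits are not too biased.  Run the postselected machine, repeated until its
  conditional error is smaller than this fraction, for all \<open>x\<close> with independent seeds, and count
  the pairs of accepting seeds and oracles.  Accepting dummy seeds of small weight make the set of
  pairs dense, so that most pairs lie in large rectangles.  Therefore some oracle has more accepting
  seeds whose answers form a row than it has erring ones, and such a row is correct.
  A verifier with a proof is treated in the same way, with the proof as part of the seed and the
  dummy seeds, of weight between the two acceptance thresholds, giving the answer "no".
  Finally one diagonalises over all machines at rapidly increasing lengths \<open>n\<close>.
\<close>

section \<open>Rectangles and rows\<close>

text \<open>Suppose \<open>J + 2\<close> rows took the value \<open>b\<close> with frequency below
  1/(2J+4) each. By the union bound at least half of \<open>F\<close> takes the other value on all
  of them, and fixing \<open>J + 2\<close> bits leaves at most 2^(card W - J - 2) sets. So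
  \<open>F\<close> would have density below 2^-J.\<close>

lemma few_biased:
  assumes "finite W" "F \<subseteq> Pow W" "2 ^ card W \<le> card F * 2 ^ J"
  shows "card {w \<in> W. (2*J+4) * card {c \<in> F. (w \<in> c) = b} < card F} \<le> J + 1"
proof (rule ccontr)
  let ?B = "{w \<in> W. (2*J+4) * card {c \<in> F. (w \<in> c) = b} < card F}"
  assume "\<not> card ?B \<le> J + 1"
  then have "J + 2 \<le> card ?B" by simp
  then obtain V where V: "V \<subseteq> ?B" "card V = J + 2" "finite V"
    by (rule obtain_subset_with_card_n)
  have VW: "V \<subseteq> W" using V(1) by auto
  have fF: "finite F" using assms finite_subset by blast
  let ?U = "\<Union>w\<in>V. {c \<in> F. (w \<in> c) = b}"
  let ?N = "{c \<in> F. \<forall>w\<in>V. (w \<in> c) = (\<not> b)}"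
  have "inj_on (\<lambda>c. c - V) ?N"
  proof (rule inj_onI)
    fix c c' assume "c \<in> ?N" "c' \<in> ?N" "c - V = c' - V"
    then show "c = c'" by (cases b) auto
  qed
  moreover have "(\<lambda>c. c - V) ` ?N \<subseteq> Pow (W - V)" using assms(2) by auto
  ultimately have "card ?N \<le> card (Pow (W - V))"
    using assms(1) by (intro card_inj_on_le) auto
  also have "\<dots> = 2 ^ (card W - (J + 2))"
    using assms(1) V VW by (simp add: card_Pow card_Diff_subset)
  finally have N: "card ?N \<le> 2 ^ (card W - (J + 2))" .
  have "(2*J+4) * card ?U \<le> (2*J+4) * (\<Sum>w\<in>V. card {c \<in> F. (w \<in> c) = b})"
    using card_UN_le[OF V(3)] by (intro mult_left_mono) auto
  also have "\<dots> = (\<Sum>w\<in>V. (2*J+4) * card {c \<in> F. (w \<in> c) = b})"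
    by (simp add: sum_distrib_left)
  also have "\<dots> \<le> (\<Sum>w\<in>V. card F)"
    using V(1) by (intro sum_mono) (auto intro: less_imp_le)
  also have "\<dots> = (J + 2) * card F" using V by simp
  finally have "(J + 2) * (2 * card ?U) \<le> (J + 2) * card F" by (simp add: algebra_simps)
  then have U: "2 * card ?U \<le> card F" by (subst (asm) mult_le_cancel1) auto
  have "F = ?U \<union> ?N" by auto
  then have "card F \<le> card ?U + card ?N" by (metis (lifting) card_Un_le)
  then have "card F \<le> 2 * 2 ^ (card W - (J + 2))" using U N by linarith
  then have "card F * 2 ^ J \<le> 2 * 2 ^ (card W - (J + 2)) * 2 ^ J" by (rule mult_right_mono) simp
  also have "\<dots> = 2 ^ (card W - (J + 2) + J + 1)" by (simp add: power_add)
  also have "\<dots> < 2 ^ card W"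
    using card_mono[OF assms(1) VW] V by (intro power_strict_increasing) auto
  finally show False using assms(3) by simp
qed

text \<open>The matrix \<open>h\<close> is stored by columns: \<open>h x\<close> is the set of rows
  with entry True in column \<open>x\<close>. A product of sets of columns is then a
  \<open>PiE\<close>.\<close>

definition planted :: "'x set \<Rightarrow> 'w set \<Rightarrow> ('x \<Rightarrow> 'w set) \<Rightarrow> ('x \<Rightarrow> bool) \<Rightarrow> bool" where
  "planted Z W h y \<longleftrightarrow> (\<exists>w\<in>W. \<forall>x\<in>Z. y x = (w \<in> h x))"

text \<open>Each side of the rectangle has density at least 2^-J, since the other sides are at most
  full. By \<open>few_biased\<close> every column excludes at most \<open>J + 1\<close> rows, so
  some row is biased in no column. Prescribing \<open>y\<close> on that row costs a factor of at
  most 2J+4 in each column.\<close>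

lemma rectangle_planted:
  assumes Z: "finite Z" and W: "finite W" and F: "\<And>x. x \<in> Z \<Longrightarrow> F x \<subseteq> Pow W"
    and large: "2 ^ (card Z * card W) \<le> card (PiE Z F) * 2 ^ J"
    and rows: "card Z * (J + 1) < card W"
  shows "card (PiE Z F) \<le> (2*J+4) ^ card Z * card {h \<in> PiE Z F. planted Z W h y}"
proof -
  let ?B = "\<lambda>x. {w \<in> W. (2*J+4) * card {c \<in> F x. (w \<in> c) = y x} < card (F x)}"
  have fF: "finite (F x)" "card (F x) \<le> 2 ^ card W" if "x \<in> Z" for x
    using F[OF that] W card_mono[of "Pow W" "F x"] by (auto intro: finite_subset simp: card_Pow)
  have "card (?B x) \<le> J + 1" if x: "x \<in> Z" for x
  proof (rule few_biased[OF W F[OF x]])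
    have "card (PiE Z F) = card (F x) * (\<Prod>x'\<in>Z - {x}. card (F x'))"
      using Z x by (simp add: card_PiE prod.remove)
    also have "\<dots> \<le> card (F x) * (\<Prod>x'\<in>Z - {x}. 2 ^ card W)"
      using fF by (intro mult_left_mono prod_mono) auto
    also have "\<dots> = card (F x) * 2 ^ (card W * (card Z - 1))"
      using Z x by (simp add: power_mult)
    finally have "2 ^ (card Z * card W) \<le> card (F x) * 2 ^ (card W * (card Z - 1)) * 2 ^ J"
      by (intro order.trans[OF large] mult_right_mono) auto
    moreover have "card Z * card W = card W + card W * (card Z - 1)"
      using Z x by (cases "card Z") auto
    ultimately have "2 ^ (card W * (card Z - 1)) * 2 ^ card W
        \<le> 2 ^ (card W * (card Z - 1)) * (card (F x) * 2 ^ J)"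
      by (simp only: power_add ac_simps)
    then show "2 ^ card W \<le> card (F x) * 2 ^ J"
      by (subst (asm) mult_le_cancel1) auto
  qed
  then have "card (\<Union>x\<in>Z. ?B x) \<le> card Z * (J + 1)"
    using sum_bounded_above[of Z "\<lambda>x. card (?B x)" "J + 1"]
    by (intro order.trans[OF card_UN_le[OF Z, of ?B]]) simp
  then have "card (\<Union>x\<in>Z. ?B x) < card W" using rows by simp
  then have "\<not> W \<subseteq> (\<Union>x\<in>Z. ?B x)"
    using card_mono[of "\<Union>x\<in>Z. ?B x" W] Z W by auto
  then obtain w where w: "w \<in> W" "\<And>x. x \<in> Z \<Longrightarrow> w \<notin> ?B x" by blast
  let ?G = "\<lambda>x. {c \<in> F x. (w \<in> c) = y x}"
  have "card (PiE Z F) = (\<Prod>x\<in>Z. card (F x))" using Z by (simp add: card_PiE)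
  also have "\<dots> \<le> (\<Prod>x\<in>Z. (2*J+4) * card (?G x))"
    using w by (intro prod_mono) (auto simp: not_less)
  also have "\<dots> = (2*J+4) ^ card Z * card (PiE Z ?G)"
    using Z by (simp add: prod.distrib card_PiE)
  also have "PiE Z ?G \<subseteq> {h \<in> PiE Z F. planted Z W h y}"
    using w(1) by (auto simp: planted_def PiE_iff)
  then have "card (PiE Z ?G) \<le> card {h \<in> PiE Z F. planted Z W h y}"
    using finite_PiE[OF Z, of F] fF by (intro card_mono) auto
  then have "(2*J+4) ^ card Z * card (PiE Z ?G) \<le>
     (2*J+4) ^ card Z * card {h \<in> PiE Z F. planted Z W h y}" by (rule mult_left_mono) simp
  finally show ?thesis .
qed

section \<open>Functions with few rectangular fibres\<close>

text \<open>The fibres of \<tau> partition the matrices into at most \<open>k\<close> combinatorial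
  rectangles, as the transcripts of a communication protocol with one party per column
  would.\<close>

definition rect_label :: "'x set \<Rightarrow> 'c set \<Rightarrow> nat \<Rightarrow> (('x \<Rightarrow> 'c) \<Rightarrow> 'k) \<Rightarrow> bool" where
  "rect_label Z C k \<tau> \<longleftrightarrow>
     finite (\<tau> ` PiE Z (\<lambda>_. C)) \<and> card (\<tau> ` PiE Z (\<lambda>_. C)) \<le> k \<and>
     (\<forall>t \<in> \<tau> ` PiE Z (\<lambda>_. C).
        \<exists>F. \<forall>h \<in> PiE Z (\<lambda>_. C). \<tau> h = t \<longleftrightarrow> (\<forall>x\<in>Z. h x \<in> F x))"

definition determines :: "'x set \<Rightarrow> 'c set \<Rightarrow> (('x \<Rightarrow> 'c) \<Rightarrow> 'k) \<Rightarrow> (('x \<Rightarrow> 'c) \<Rightarrow> 'l) \<Rightarrow> bool" where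
  "determines Z C \<tau> f \<longleftrightarrow>
     (\<forall>h \<in> PiE Z (\<lambda>_. C). \<forall>h' \<in> PiE Z (\<lambda>_. C). \<tau> h = \<tau> h' \<longrightarrow> f h = f h')"

text \<open>Labels are natural numbers because the label type cannot be quantified here;
  \<open>protocolI\<close> admits labels of any type.\<close>

definition protocol :: "'x set \<Rightarrow> 'c set \<Rightarrow> nat \<Rightarrow> (('x \<Rightarrow> 'c) \<Rightarrow> 'l) \<Rightarrow> bool" where
  "protocol Z C k f \<longleftrightarrow>
     (\<exists>\<tau> :: ('x \<Rightarrow> 'c) \<Rightarrow> nat. rect_label Z C k \<tau> \<and> determines Z C \<tau> f)"

lemma protocolI:
  fixes \<tau> :: "('x \<Rightarrow> 'c) \<Rightarrow> 'k"
  assumes "rect_label Z C k \<tau>" "determines Z C \<tau> f"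
  shows "protocol Z C k f"
proof -
  let ?U = "PiE Z (\<lambda>_. C)"
  have fin: "finite (\<tau> ` ?U)" and card: "card (\<tau> ` ?U) \<le> k"
    using assms(1) unfolding rect_label_def by blast+
  obtain g :: "'k \<Rightarrow> nat" where g: "inj_on g (\<tau> ` ?U)"
    using finite_imp_inj_to_nat_seg[OF fin] by blast
  have eq: "g (\<tau> h) = g (\<tau> h') \<longleftrightarrow> \<tau> h = \<tau> h'" if "h \<in> ?U" "h' \<in> ?U" for h h'
    using inj_on_eq_iff[OF g] that by blast
  have img: "(g \<circ> \<tau>) ` ?U = g ` \<tau> ` ?U" by (rule image_comp[symmetric])
  have "rect_label Z C k (g \<circ> \<tau>)" unfolding rect_label_def
  proof (intro conjI ballI)
    show "finite ((g \<circ> \<tau>) ` ?U)" unfolding img using fin by (rule finite_imageI)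
    show "card ((g \<circ> \<tau>) ` ?U) \<le> k" unfolding img using card card_image[OF g] by simp
    fix t assume "t \<in> (g \<circ> \<tau>) ` ?U"
    then obtain h where h: "h \<in> ?U" "t = g (\<tau> h)" by auto
    obtain F where "\<forall>h' \<in> ?U. \<tau> h' = \<tau> h \<longleftrightarrow> (\<forall>x\<in>Z. h' x \<in> F x)"
      using assms(1) h(1) unfolding rect_label_def by blast
    then show "\<exists>F. \<forall>h\<in>?U. (g \<circ> \<tau>) h = t \<longleftrightarrow> (\<forall>x\<in>Z. h x \<in> F x)"
      using eq[OF _ h(1)] unfolding h(2) comp_def by blast
  qed
  moreover have "determines Z C (g \<circ> \<tau>) f"
    using assms(2) eq unfolding determines_def comp_def by blast
  ultimately show ?thesis unfolding protocol_def by blast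
qed

lemma protocol_mono: "protocol Z C k f \<Longrightarrow> k \<le> k' \<Longrightarrow> protocol Z C k' f"
proof -
  assume a: "protocol Z C k f" "k \<le> k'"
  obtain \<tau> :: "_ \<Rightarrow> nat" where \<tau>: "rect_label Z C k \<tau>" "determines Z C \<tau> f"
    using a(1) unfolding protocol_def by blast
  then have "rect_label Z C k' \<tau>" using a(2) unfolding rect_label_def by (elim conjE, intro conjI) simp_all
  then show ?thesis using \<tau>(2) by (rule protocolI)
qed

lemma protocol_comp:
  assumes "protocol Z C k f" "determines Z C f g"
  shows "protocol Z C k g"
proof -
  obtain \<tau> :: "_ \<Rightarrow> nat" where \<tau>: "rect_label Z C k \<tau>" "determines Z C \<tau> f"
    using assms(1) unfolding protocol_def by blast
  have "determines Z C \<tau> g" using \<tau>(2) assms(2) unfolding determines_def by blast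
  with \<tau>(1) show ?thesis by (rule protocolI)
qed

lemma protocol_const:
  assumes "1 \<le> k"
  shows "protocol Z C k (\<lambda>_. v)"
proof -
  have "card ((\<lambda>_. ()) ` PiE Z (\<lambda>_. C)) \<le> card {()}" by (rule card_mono) auto
  then have "rect_label Z C k (\<lambda>_. ())"
    using assms unfolding rect_label_def by (auto intro: exI[of _ "\<lambda>_. UNIV"])
  then show ?thesis by (rule protocolI) (simp add: determines_def)
qed

text \<open>The joint label is the tuple of the single labels. Its fibres are intersections of
  rectangles, hence rectangles, and the numbers of labels multiply.\<close>

lemma protocol_restrict:
  assumes "finite I" and "\<And>i. i \<in> I \<Longrightarrow> protocol Z C k (f i)"
  shows "protocol Z C (k ^ card I) (\<lambda>h. \<lambda>i\<in>I. f i h)"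
proof -
  let ?U = "PiE Z (\<lambda>_. C)"
  have "\<forall>i\<in>I. \<exists>\<tau> :: _ \<Rightarrow> nat. rect_label Z C k \<tau> \<and> determines Z C \<tau> (f i)"
    using assms(2) unfolding protocol_def by blast
  then obtain \<tau> :: "_ \<Rightarrow> _ \<Rightarrow> nat"
    where \<tau>: "\<And>i. i \<in> I \<Longrightarrow> rect_label Z C k (\<tau> i)" "\<And>i. i \<in> I \<Longrightarrow> determines Z C (\<tau> i) (f i)"
    by metis
  define \<sigma> where "\<sigma> h = (\<lambda>i\<in>I. \<tau> i h)" for h
  have \<sigma>_eq: "\<sigma> h = \<sigma> h' \<longleftrightarrow> (\<forall>i\<in>I. \<tau> i h = \<tau> i h')" for h h'
    unfolding \<sigma>_def by (auto simp: fun_eq_iff restrict_def)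
  have sub: "\<sigma> ` ?U \<subseteq> PiE I (\<lambda>i. \<tau> i ` ?U)" unfolding \<sigma>_def by auto
  have fin: "finite (PiE I (\<lambda>i. \<tau> i ` ?U))"
    using assms(1) \<tau>(1) unfolding rect_label_def by (intro finite_PiE) auto
  have "rect_label Z C (k ^ card I) \<sigma>" unfolding rect_label_def
  proof (intro conjI ballI)
    show "finite (\<sigma> ` ?U)" using sub fin by (rule finite_subset)
    have "card (\<sigma> ` ?U) \<le> card (PiE I (\<lambda>i. \<tau> i ` ?U))" using fin sub by (rule card_mono)
    also have "\<dots> = (\<Prod>i\<in>I. card (\<tau> i ` ?U))" using assms(1) by (rule card_PiE)
    also have "\<dots> \<le> (\<Prod>i\<in>I. k)" using \<tau>(1) unfolding rect_label_def by (intro prod_mono) auto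
    finally show "card (\<sigma> ` ?U) \<le> k ^ card I" by simp
    fix t assume "t \<in> \<sigma> ` ?U"
    then obtain h where h: "h \<in> ?U" "t = \<sigma> h" by blast
    have "\<forall>i\<in>I. \<exists>F. \<forall>h'\<in>?U. \<tau> i h' = \<tau> i h \<longleftrightarrow> (\<forall>x\<in>Z. h' x \<in> F x)"
      using \<tau>(1) h(1) unfolding rect_label_def by blast
    then obtain F where F: "\<forall>i\<in>I. \<forall>h'\<in>?U. \<tau> i h' = \<tau> i h \<longleftrightarrow> (\<forall>x\<in>Z. h' x \<in> F i x)"
      by (elim bchoice[THEN exE])
    have "\<sigma> h' = t \<longleftrightarrow> (\<forall>x\<in>Z. h' x \<in> (\<Inter>i\<in>I. F i x))" if "h' \<in> ?U" for h'
    proof -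
      have "\<sigma> h' = t \<longleftrightarrow> (\<forall>i\<in>I. \<forall>x\<in>Z. h' x \<in> F i x)"
        unfolding h(2) \<sigma>_eq using F that by blast
      then show ?thesis by blast
    qed
    then show "\<exists>F. \<forall>h\<in>?U. \<sigma> h = t \<longleftrightarrow> (\<forall>x\<in>Z. h x \<in> F x)"
      by (intro exI[of _ "\<lambda>x. \<Inter>i\<in>I. F i x"] ballI)
  qed
  then show ?thesis
  proof (rule protocolI)
    show "determines Z C \<sigma> (\<lambda>h. \<lambda>i\<in>I. f i h)"
      using \<tau>(2) unfolding determines_def \<sigma>_eq by (intro ballI impI restrict_ext) blast
  qed
qed

text \<open>This is adaptive composition: each rectangle on which \<mu> is constant is partitioned
  further by a protocol chosen according to that value.\<close>

lemma protocol_bind: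
  assumes "protocol Z C k \<mu>"
    and f: "\<And>v. v \<in> \<mu> ` PiE Z (\<lambda>_. C) \<Longrightarrow> protocol Z C l (f v)"
  shows "protocol Z C (k * l) (\<lambda>h. f (\<mu> h) h)"
proof -
  let ?U = "PiE Z (\<lambda>_. C)"
  obtain \<sigma> :: "_ \<Rightarrow> nat" where \<sigma>: "rect_label Z C k \<sigma>" "determines Z C \<sigma> \<mu>"
    using assms(1) unfolding protocol_def by blast
  \<comment> \<open>The value of \<mu> at some matrix with label \<open>s\<close>. As \<sigma>
    determines \<mu>, it is the value on the whole rectangle, so the second protocol can be chosen
    from \<open>s\<close> alone.\<close>
  define \<nu> where "\<nu> s = \<mu> (SOME h. h \<in> ?U \<and> \<sigma> h = s)" for s
  have \<mu>\<nu>: "\<mu> h = \<nu> (\<sigma> h)" if "h \<in> ?U" for h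
  proof -
    have "\<nu> (\<sigma> h) = \<mu> h'" "h' \<in> ?U \<and> \<sigma> h' = \<sigma> h"
      if "h' = (SOME h'. h' \<in> ?U \<and> \<sigma> h' = \<sigma> h)" for h'
      using that someI[of "\<lambda>h'. h' \<in> ?U \<and> \<sigma> h' = \<sigma> h" h] \<open>h \<in> ?U\<close> by (simp_all add: \<nu>_def)
    then show ?thesis using \<sigma>(2) \<open>h \<in> ?U\<close> unfolding determines_def by metis
  qed
  have "protocol Z C l (f (\<nu> s))" if "s \<in> \<sigma> ` ?U" for s
  proof -
    obtain h where h: "h \<in> ?U" "s = \<sigma> h" using \<open>s \<in> \<sigma> ` ?U\<close> by (rule imageE)
    then have "\<nu> s = \<mu> h" using \<mu>\<nu> by simp
    then show ?thesis using f[of "\<mu> h"] h(1) by simp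
  qed
  then have "\<forall>s\<in>\<sigma> ` ?U. \<exists>\<tau> :: _ \<Rightarrow> nat. rect_label Z C l \<tau> \<and> determines Z C \<tau> (f (\<nu> s))"
    unfolding protocol_def by blast
  then obtain \<tau> :: "_ \<Rightarrow> _ \<Rightarrow> nat"
    where \<tau>': "\<forall>s\<in>\<sigma> ` ?U. rect_label Z C l (\<tau> s) \<and> determines Z C (\<tau> s) (f (\<nu> s))"
    by (elim bchoice[THEN exE])
  have \<tau>: "rect_label Z C l (\<tau> s)" "determines Z C (\<tau> s) (f (\<nu> s))" if "s \<in> \<sigma> ` ?U" for s
    using bspec[OF \<tau>' that] by (rule conjunct1, rule conjunct2)
  define \<rho> where "\<rho> h = (\<sigma> h, \<tau> (\<sigma> h) h)" for h
  have \<rho>_eq: "\<rho> h' = \<rho> h \<longleftrightarrow> \<sigma> h' = \<sigma> h \<and> \<tau> (\<sigma> h) h' = \<tau> (\<sigma> h) h" for h h'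
    unfolding \<rho>_def by auto
  have sub: "\<rho> ` ?U \<subseteq> Sigma (\<sigma> ` ?U) (\<lambda>s. \<tau> s ` ?U)" unfolding \<rho>_def by auto
  have fin: "finite (Sigma (\<sigma> ` ?U) (\<lambda>s. \<tau> s ` ?U))"
    using \<sigma>(1) \<tau>(1) unfolding rect_label_def by (intro finite_SigmaI) auto
  have "rect_label Z C (k * l) \<rho>" unfolding rect_label_def
  proof (intro conjI ballI)
    show "finite (\<rho> ` ?U)" using sub fin by (rule finite_subset)
    have "card (\<rho> ` ?U) \<le> card (Sigma (\<sigma> ` ?U) (\<lambda>s. \<tau> s ` ?U))" using fin sub by (rule card_mono)
    also have "\<dots> = (\<Sum>s\<in>\<sigma> ` ?U. card (\<tau> s ` ?U))"
      using \<sigma>(1) \<tau>(1) unfolding rect_label_def by (intro card_SigmaI) auto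
    also have "\<dots> \<le> (\<Sum>s\<in>\<sigma> ` ?U. l)" using \<tau>(1) unfolding rect_label_def by (intro sum_mono) auto
    also have "\<dots> \<le> k * l" using \<sigma>(1) unfolding rect_label_def by simp
    finally show "card (\<rho> ` ?U) \<le> k * l" .
    fix t assume "t \<in> \<rho> ` ?U"
    then obtain h where h: "h \<in> ?U" "t = \<rho> h" by blast
    obtain F where F: "\<forall>h'\<in>?U. \<sigma> h' = \<sigma> h \<longleftrightarrow> (\<forall>x\<in>Z. h' x \<in> F x)"
      using \<sigma>(1) h(1) unfolding rect_label_def by blast
    have "rect_label Z C l (\<tau> (\<sigma> h))" using \<tau>(1) h(1) by blast
    then obtain F' where F': "\<forall>h'\<in>?U. \<tau> (\<sigma> h) h' = \<tau> (\<sigma> h) h \<longleftrightarrow> (\<forall>x\<in>Z. h' x \<in> F' x)"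
      using h(1) unfolding rect_label_def by blast
    have "\<rho> h' = t \<longleftrightarrow> (\<forall>x\<in>Z. h' x \<in> F x \<inter> F' x)" if "h' \<in> ?U" for h'
      unfolding h(2) \<rho>_eq using F F' that by blast
    then show "\<exists>F. \<forall>h\<in>?U. \<rho> h = t \<longleftrightarrow> (\<forall>x\<in>Z. h x \<in> F x)"
      by (intro exI[of _ "\<lambda>x. F x \<inter> F' x"] ballI)
  qed
  then show ?thesis
  proof (rule protocolI)
    show "determines Z C \<rho> (\<lambda>h. f (\<mu> h) h)" unfolding determines_def
    proof (intro ballI impI)
      fix h' h assume h: "h' \<in> ?U" "h \<in> ?U" "\<rho> h' = \<rho> h"
      then have \<sigma>': "\<sigma> h' = \<sigma> h" "\<tau> (\<sigma> h) h' = \<tau> (\<sigma> h) h" unfolding \<rho>_eq by blast+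
      have "determines Z C (\<tau> (\<sigma> h)) (f (\<nu> (\<sigma> h)))" using \<tau>(2) h(2) by blast
      then have "f (\<nu> (\<sigma> h)) h' = f (\<nu> (\<sigma> h)) h"
        using h(1,2) \<sigma>'(2) unfolding determines_def by blast
      then show "f (\<mu> h') h' = f (\<mu> h) h" using \<mu>\<nu>[OF h(1)] \<mu>\<nu>[OF h(2)] \<sigma>'(1) by simp
    qed
  qed
qed

section \<open>Counting pairs of seeds and oracles\<close>

lemma sum_card_swap:
  assumes "finite A" "finite B"
  shows "(\<Sum>a\<in>A. card {b \<in> B. R a b}) = (\<Sum>b\<in>B. card {a \<in> A. R a b})"
proof -
  have "(\<Sum>a\<in>A. card {b \<in> B. R a b}) = (\<Sum>a\<in>A. \<Sum>b\<in>B. if R a b then 1 else 0)"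
    using assms by (simp add: sum.If_cases Int_def)
  also have "\<dots> = (\<Sum>b\<in>B. \<Sum>a\<in>A. if R a b then 1 else 0)" by (rule sum.swap)
  also have "\<dots> = (\<Sum>b\<in>B. card {a \<in> A. R a b})"
    using assms by (simp add: sum.If_cases Int_def)
  finally show ?thesis .
qed

lemma card_eq_sum_fibres:
  assumes "finite U" "S \<subseteq> U"
  shows "card S = (\<Sum>t\<in>\<tau> ` U. card {h \<in> S. \<tau> h = t})"
  using sum.group[of S "\<tau> ` U" \<tau> "\<lambda>_. 1 :: nat", OF finite_subset[OF assms(2,1)]
      finite_imageI[OF assms(1)] image_mono[OF assms(2)]] by simp

text \<open>\<open>None\<close> means rejection. On each rectangle of the partition \<open>g\<close>
  is constant, so \<open>rectangle_planted\<close> applies with a fixed answer vector if the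
  rectangle has density at least 2^-J. The at most \<open>k\<close> smaller ones are paid for by the
  last summand.\<close>

lemma protocol_planted:
  assumes Z: "finite Z" and W: "finite W" and g: "protocol Z (Pow W) k g"
    and rows: "card Z * (J + 1) < card W"
  defines "U \<equiv> PiE Z (\<lambda>_. Pow W)"
  shows "card {h \<in> U. g h \<noteq> None} * 2 ^ J
    \<le> (2*J+4) ^ card Z * 2 ^ J * card {h \<in> U. \<exists>y. g h = Some y \<and> planted Z W h y}
      + k * 2 ^ (card Z * card W)"
proof -
  let ?P = "{h \<in> U. \<exists>y. g h = Some y \<and> planted Z W h y}"
  obtain \<tau> :: "_ \<Rightarrow> nat" where \<tau>: "rect_label Z (Pow W) k \<tau>" "determines Z (Pow W) \<tau> g"
    using g unfolding protocol_def by blast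
  have fU: "finite U" unfolding U_def using Z W by (intro finite_PiE) auto
  define A where "A t = {h \<in> U. g h \<noteq> None \<and> \<tau> h = t}" for t
  define P where "P t = {h \<in> ?P. \<tau> h = t}" for t
  have step: "card (A t) * 2 ^ J \<le> (2*J+4) ^ card Z * 2 ^ J * card (P t) + 2 ^ (card Z * card W)"
    if t: "t \<in> \<tau> ` U" for t
  proof (cases "A t = {}")
    case True
    then show ?thesis by simp
  next
    case False
    then obtain h0 y where h0: "h0 \<in> U" "g h0 = Some y" "\<tau> h0 = t" by (auto simp: A_def)
    have "\<exists>F. \<forall>h \<in> U. \<tau> h = t \<longleftrightarrow> (\<forall>x\<in>Z. h x \<in> F x)"
      using \<tau>(1) t unfolding rect_label_def U_def by (elim conjE bspec)
    then obtain F where F: "\<forall>h \<in> U. \<tau> h = t \<longleftrightarrow> (\<forall>x\<in>Z. h x \<in> F x)" ..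
    have same: "g h = Some y" if "h \<in> U" "\<tau> h = t" for h
      using \<tau>(2) that h0 unfolding determines_def U_def by metis
    let ?F = "\<lambda>x. F x \<inter> Pow W"
    \<comment> \<open>One accepted matrix makes all matrices with the same label accepted, with the
      same answers, so \<open>A t\<close> is the full rectangle.\<close>
    have A: "A t = PiE Z ?F"
    proof (rule Set.set_eqI)
      fix h
      have "h \<in> PiE Z ?F \<longleftrightarrow> h \<in> U \<and> (\<forall>x\<in>Z. h x \<in> F x)"
        unfolding U_def PiE_iff by blast
      also have "\<dots> \<longleftrightarrow> h \<in> U \<and> \<tau> h = t" using F by blast
      also have "\<dots> \<longleftrightarrow> h \<in> A t" using same unfolding A_def by auto
      finally show "h \<in> A t \<longleftrightarrow> h \<in> PiE Z ?F" by blast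
    qed
    have P: "P t = {h \<in> PiE Z ?F. planted Z W h y}"
      unfolding A[symmetric] using same by (auto simp: A_def P_def)
    show ?thesis
    proof (cases "2 ^ (card Z * card W) \<le> card (PiE Z ?F) * 2 ^ J")
      case True
      have "card (A t) \<le> (2*J+4) ^ card Z * card (P t)"
        unfolding P unfolding A by (rule rectangle_planted[OF Z W _ True rows]) auto
      then have "card (A t) * 2 ^ J \<le> (2*J+4) ^ card Z * card (P t) * 2 ^ J"
        by (rule mult_right_mono) simp
      also have "\<dots> = (2*J+4) ^ card Z * 2 ^ J * card (P t)" by (simp only: ac_simps)
      finally show ?thesis by (rule trans_le_add1)
    next
      case False
      then show ?thesis by (simp add: A)
    qed
  qed
  have sumA: "card {h \<in> U. g h \<noteq> None} = (\<Sum>t\<in>\<tau> ` U. card (A t))"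
    using card_eq_sum_fibres[OF fU, of "{h \<in> U. g h \<noteq> None}" \<tau>] by (simp add: A_def)
  have sumP: "card ?P = (\<Sum>t\<in>\<tau> ` U. card (P t))"
    unfolding P_def by (rule card_eq_sum_fibres[OF fU]) blast
  have "card {h \<in> U. g h \<noteq> None} * 2 ^ J = (\<Sum>t\<in>\<tau> ` U. card (A t) * 2 ^ J)"
    unfolding sumA by (rule sum_distrib_right)
  also have "\<dots> \<le> (\<Sum>t\<in>\<tau> ` U. (2*J+4) ^ card Z * 2 ^ J * card (P t) + 2 ^ (card Z * card W))"
    using step by (rule sum_mono)
  also have "\<dots> = (2*J+4) ^ card Z * 2 ^ J * card ?P + card (\<tau> ` U) * 2 ^ (card Z * card W)"
    unfolding sumP by (simp add: sum.distrib sum_distrib_left)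
  also have "\<dots> \<le> (2*J+4) ^ card Z * 2 ^ J * card ?P + k * 2 ^ (card Z * card W)"
    using \<tau>(1) unfolding rect_label_def U_def by (intro add_left_mono mult_right_mono) auto
  finally show ?thesis .
qed

text \<open>Double counting of accepted pairs of a seed and a matrix. They form at least a fraction
  1/Q of all pairs, so by the choice of \<open>J\<close> the tiny rectangles contain at most half of
  them. If every matrix failed the claim, summing over the matrices would contradict the resulting
  bound.\<close>

lemma exists_planted:
  assumes Z: "finite Z" and W: "finite W" and \<Psi>: "finite \<Psi>" "\<Psi> \<noteq> {}"
    and g: "\<And>\<rho>. \<rho> \<in> \<Psi> \<Longrightarrow> protocol Z (Pow W) k (g \<rho>)"
    and rows: "card Z * (J + 1) < card W"
  defines "U \<equiv> PiE Z (\<lambda>_. Pow W)"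
  assumes dense: "card \<Psi> * 2 ^ (card Z * card W) \<le> Q * (\<Sum>\<rho>\<in>\<Psi>. card {h \<in> U. g \<rho> h \<noteq> None})"
    and J: "2 * k * Q \<le> 2 ^ J"
  shows "\<exists>h\<in>U. {\<rho> \<in> \<Psi>. g \<rho> h \<noteq> None} \<noteq> {} \<and>
     card {\<rho> \<in> \<Psi>. g \<rho> h \<noteq> None}
       \<le> 2 * (2*J+4) ^ card Z * card {\<rho> \<in> \<Psi>. \<exists>y. g \<rho> h = Some y \<and> planted Z W h y}"
proof (rule ccontr)
  let ?a = "\<lambda>h. card {\<rho> \<in> \<Psi>. g \<rho> h \<noteq> None}"
  let ?p = "\<lambda>h. card {\<rho> \<in> \<Psi>. \<exists>y. g \<rho> h = Some y \<and> planted Z W h y}"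
  let ?A = "\<Sum>\<rho>\<in>\<Psi>. card {h \<in> U. g \<rho> h \<noteq> None}"
  let ?P = "\<Sum>\<rho>\<in>\<Psi>. card {h \<in> U. \<exists>y. g \<rho> h = Some y \<and> planted Z W h y}"
  let ?N = "2 ^ (card Z * card W) :: nat"
  let ?E = "(2*J+4) ^ card Z"
  assume neg: "\<not> ?thesis"
  have fU: "finite U" unfolding U_def using Z W by (intro finite_PiE) auto
  have "0 < card \<Psi> * ?N" using \<Psi> by (simp add: card_gt_0_iff)
  then have "0 < Q * ?A" using dense by (rule less_le_trans)
  then have pos: "0 < ?A" by (rule contrapos_pp) (simp only: not_less le_zero_eq mult_0_right)
  have "?A * 2 ^ J = (\<Sum>\<rho>\<in>\<Psi>. card {h \<in> U. g \<rho> h \<noteq> None} * 2 ^ J)" by (rule sum_distrib_right)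
  also have "\<dots> \<le> (\<Sum>\<rho>\<in>\<Psi>. ?E * 2 ^ J * card {h \<in> U. \<exists>y. g \<rho> h = Some y \<and> planted Z W h y} + k * ?N)"
    unfolding U_def by (intro sum_mono protocol_planted[OF Z W g rows])
  also have "\<dots> = ?E * 2 ^ J * ?P + k * (card \<Psi> * ?N)"
    by (simp add: sum.distrib sum_distrib_left)
  finally have "?A * 2 ^ J \<le> ?E * 2 ^ J * ?P + k * (card \<Psi> * ?N)" .
  moreover have "k * (card \<Psi> * ?N) \<le> k * (Q * ?A)" using dense by (rule mult_left_mono) simp
  moreover have "2 * k * Q * ?A \<le> 2 ^ J * ?A" using J by (rule mult_right_mono) simp
  ultimately have "2 * (?A * 2 ^ J) \<le> 2 * (?E * 2 ^ J * ?P) + 2 ^ J * ?A"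
    by (simp only: mult.assoc)
  then have "2 ^ J * ?A \<le> 2 ^ J * (2 * ?E * ?P)" by (simp add: algebra_simps)
  then have le: "?A \<le> 2 * ?E * ?P" by (subst (asm) mult_le_cancel1) auto
  have A: "?A = (\<Sum>h\<in>U. ?a h)" by (rule sum_card_swap[OF \<Psi>(1) fU])
  have P: "?P = (\<Sum>h\<in>U. ?p h)" by (rule sum_card_swap[OF \<Psi>(1) fU])
  have lt: "2 * ?E * ?p h < ?a h" if "h \<in> U" "?a h \<noteq> 0" for h
    using neg that by (auto simp: not_le card_eq_0_iff)
  \<comment> \<open>Matrices without accepted seeds satisfy only the weak inequality; a strict sum
    needs one matrix that has an accepted seed.\<close>
  have "2 * ?E * ?p h \<le> ?a h" if h: "h \<in> U" for h
  proof (cases "?a h = 0")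
    case True
    then have "{\<rho> \<in> \<Psi>. g \<rho> h \<noteq> None} = {}" using \<Psi>(1) by simp
    then have "{\<rho> \<in> \<Psi>. \<exists>y. g \<rho> h = Some y \<and> planted Z W h y} = {}" by auto
    then show ?thesis by (simp only: card.empty)
  qed (use lt[OF h] in simp)
  moreover have "\<exists>h\<in>U. ?a h \<noteq> 0"
  proof (rule ccontr)
    assume "\<not> ?thesis"
    then have "(\<Sum>h\<in>U. ?a h) = 0" by (intro sum.neutral) blast
    then show False using pos A by linarith
  qed
  ultimately have "(\<Sum>h\<in>U. 2 * ?E * ?p h) < (\<Sum>h\<in>U. ?a h)"
    using lt by (intro sum_strict_mono_ex1[OF fU]) blast+
  then show False using le A P by (simp add: sum_distrib_left)
qed

text \<open>\<open>exists_planted\<close> is applied to vectors of independent seeds, one per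
  column. For the matrix \<open>h\<close> found, the accepted vectors whose answers form a row
  outnumber those erring in some column where errors are rare. So some row is right in all these
  columns, where being right refers to runs on \<open>h\<close> itself.\<close>

lemma planting:
  fixes f :: "'x \<Rightarrow> 's \<Rightarrow> ('x \<Rightarrow> 'w set) \<Rightarrow> bool option"
  assumes Z: "finite Z" "Z \<noteq> {}" and W: "finite W"
    and \<Omega>: "finite \<Omega>" "\<Omega>' \<subseteq> \<Omega>" "\<Omega>' \<noteq> {}" "card \<Omega> \<le> 2 ^ d * card \<Omega>'"
    and f: "\<And>x \<omega>. x \<in> Z \<Longrightarrow> \<omega> \<in> \<Omega> \<Longrightarrow> protocol Z (Pow W) (2 ^ s) (f x \<omega>)"
    and f': "\<And>x \<omega> h. x \<in> Z \<Longrightarrow> \<omega> \<in> \<Omega>' \<Longrightarrow> f x \<omega> h \<noteq> None"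
  defines "J \<equiv> 1 + card Z * (s + d)"
  assumes rows: "card Z * (J + 1) < card W" and E: "4 * card Z * (2*J+4) ^ card Z < E"
  shows "\<exists>h \<in> PiE Z (\<lambda>_. Pow W). \<exists>w\<in>W. \<forall>x\<in>Z. \<forall>b.
     E * card {\<omega> \<in> \<Omega>. f x \<omega> h = Some (\<not> b)} \<le> card {\<omega> \<in> \<Omega>. f x \<omega> h \<noteq> None} \<longrightarrow> (w \<in> h x) = b"
proof -
  let ?U = "PiE Z (\<lambda>_. Pow W)" and ?\<Psi> = "PiE Z (\<lambda>_. \<Omega>)" and ?M = "card Z"
  \<comment> \<open>A vector of seeds is accepted only if every column accepts its own seed; only
    then is there a full vector of answers to look for among the rows.\<close>
  define g where "g \<rho> h = (if \<forall>x\<in>Z. f x (\<rho> x) h \<noteq> None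
      then Some (\<lambda>x\<in>Z. the (f x (\<rho> x) h)) else None)" for \<rho> h
  have fin\<Psi>: "finite ?\<Psi>" using Z \<Omega> by (intro finite_PiE) auto
  have ne\<Psi>: "?\<Psi> \<noteq> {}" using \<Omega> by (auto simp: PiE_eq_empty_iff)
  have fin': "finite \<Omega>'" using \<Omega> finite_subset by blast
  have "\<exists>h\<in>?U. {\<rho> \<in> ?\<Psi>. g \<rho> h \<noteq> None} \<noteq> {} \<and>
     card {\<rho> \<in> ?\<Psi>. g \<rho> h \<noteq> None}
       \<le> 2 * (2*J+4) ^ ?M * card {\<rho> \<in> ?\<Psi>. \<exists>y. g \<rho> h = Some y \<and> planted Z W h y}"
  proof (rule exists_planted[OF Z(1) W fin\<Psi> ne\<Psi> _ rows])
    fix \<rho> assume \<rho>: "\<rho> \<in> ?\<Psi>"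
    have "protocol Z (Pow W) ((2 ^ s) ^ ?M) (\<lambda>h. \<lambda>x\<in>Z. f x (\<rho> x) h)"
      using Z(1) f \<rho> by (intro protocol_restrict) (auto simp: PiE_iff)
    then show "protocol Z (Pow W) ((2 ^ s) ^ ?M) (g \<rho>)"
    proof (rule protocol_comp)
      show "determines Z (Pow W) (\<lambda>h. \<lambda>x\<in>Z. f x (\<rho> x) h) (g \<rho>)"
        unfolding determines_def
      proof (intro ballI impI)
        fix h h' assume "(\<lambda>x\<in>Z. f x (\<rho> x) h) = (\<lambda>x\<in>Z. f x (\<rho> x) h')"
        then have "f x (\<rho> x) h = f x (\<rho> x) h'" if "x \<in> Z" for x
          using that by (auto dest: fun_cong[of _ _ x])
        then show "g \<rho> h = g \<rho> h'" unfolding g_def by (auto intro!: restrict_ext)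
      qed
    qed
  next
    \<comment> \<open>Vectors of dummy seeds are accepted for every matrix. They are at least a
      fraction \<open>(2 ^ d) ^ card Z\<close> in the denominator of all vectors, which supplies the
      density \<open>Q\<close>.\<close>
    have "card (PiE Z (\<lambda>_. \<Omega>')) * 2 ^ (?M * card W) = (\<Sum>\<rho>\<in>PiE Z (\<lambda>_. \<Omega>'). card ?U)"
      using Z W by (simp add: card_PiE card_Pow flip: power_mult)
    also have "\<dots> = (\<Sum>\<rho>\<in>PiE Z (\<lambda>_. \<Omega>'). card {h \<in> ?U. g \<rho> h \<noteq> None})"
    proof (rule sum.cong[OF refl])
      fix \<rho> assume "\<rho> \<in> PiE Z (\<lambda>_. \<Omega>')"
      then have "g \<rho> h \<noteq> None" for h using f' by (auto simp: g_def PiE_iff)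
      then show "card ?U = card {h \<in> ?U. g \<rho> h \<noteq> None}" by simp
    qed
    also have "\<dots> \<le> (\<Sum>\<rho>\<in>?\<Psi>. card {h \<in> ?U. g \<rho> h \<noteq> None})"
      using fin\<Psi> \<Omega>(2) by (intro sum_mono2) (auto simp: PiE_iff)
    finally have le: "card (PiE Z (\<lambda>_. \<Omega>')) * 2 ^ (?M * card W)
      \<le> (\<Sum>\<rho>\<in>?\<Psi>. card {h \<in> ?U. g \<rho> h \<noteq> None})" .
    have "card ?\<Psi> = card \<Omega> ^ ?M" using Z by (simp add: card_PiE)
    also have "\<dots> \<le> (2 ^ d * card \<Omega>') ^ ?M" using \<Omega>(4) by (rule power_mono) simp
    also have "\<dots> = (2 ^ d) ^ ?M * card (PiE Z (\<lambda>_. \<Omega>'))"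
      using Z by (simp add: card_PiE power_mult_distrib)
    finally have "card ?\<Psi> * 2 ^ (?M * card W)
      \<le> (2 ^ d) ^ ?M * card (PiE Z (\<lambda>_. \<Omega>')) * 2 ^ (?M * card W)" by (rule mult_right_mono) simp
    also have "\<dots> \<le> (2 ^ d) ^ ?M * (\<Sum>\<rho>\<in>?\<Psi>. card {h \<in> ?U. g \<rho> h \<noteq> None})"
      unfolding mult.assoc using le by (rule mult_left_mono) simp
    finally show "card ?\<Psi> * 2 ^ (?M * card W)
      \<le> (2 ^ d) ^ ?M * (\<Sum>\<rho>\<in>?\<Psi>. card {h \<in> ?U. g \<rho> h \<noteq> None})" .
    \<comment> \<open>The definition of \<open>J\<close> makes \<open>2 * k * Q\<close> exactly a
      power of two.\<close>
    have "2 * (2 ^ s) ^ ?M * (2 ^ d) ^ ?M = (2 :: nat) ^ J"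
      by (simp add: J_def algebra_simps flip: power_mult power_add)
    then show "2 * (2 ^ s) ^ ?M * (2 ^ d) ^ ?M \<le> (2 :: nat) ^ J" by simp
  qed
  then obtain h where h: "h \<in> ?U" "{\<rho> \<in> ?\<Psi>. g \<rho> h \<noteq> None} \<noteq> {}"
    "card {\<rho> \<in> ?\<Psi>. g \<rho> h \<noteq> None}
       \<le> 2 * (2*J+4) ^ ?M * card {\<rho> \<in> ?\<Psi>. \<exists>y. g \<rho> h = Some y \<and> planted Z W h y}"
    by (elim bexE conjE)
  \<comment> \<open>\<open>S\<close> collects the accepted seeds and \<open>V\<close> those
    answering against \<open>b\<close>. \<open>G\<close> holds the pairs for which such errors are
    rare, and \<open>Bad\<close> the accepted seed vectors that err at a given pair.\<close>
  define S where "S x = {\<omega> \<in> \<Omega>. f x \<omega> h \<noteq> None}" for x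
  define V where "V x b = {\<omega> \<in> \<Omega>. f x \<omega> h = Some (\<not> b)}" for x b
  define G where "G = {(x, b). x \<in> Z \<and> E * card (V x b) \<le> card (S x)}"
  define Bad where "Bad z = PiE Z (S(fst z := V (fst z) (snd z)))" for z
  let ?P = "{\<rho> \<in> ?\<Psi>. \<exists>y. g \<rho> h = Some y \<and> planted Z W h y}"
  have acc: "{\<rho> \<in> ?\<Psi>. g \<rho> h \<noteq> None} = PiE Z S"
  proof (rule Set.set_eqI)
    fix \<rho>
    show "\<rho> \<in> {\<rho> \<in> ?\<Psi>. g \<rho> h \<noteq> None} \<longleftrightarrow> \<rho> \<in> PiE Z S"
      unfolding g_def S_def PiE_iff mem_Collect_eq by simp blast
  qed
  have finS: "finite (S x)" "finite (V x b)" for x b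
    using \<Omega>(1) by (simp_all add: S_def V_def)
  have GX: "G \<subseteq> Z \<times> UNIV" by (auto simp: G_def)
  have finG: "finite G" using GX Z(1) by (rule finite_subset[OF _ finite_cartesian_product]) simp
  have "card G \<le> card (Z \<times> (UNIV :: bool set))" using Z(1) GX by (intro card_mono) auto
  then have cG: "card G \<le> 2 * ?M" using Z(1) by (simp add: card_cartesian_product)
  have EBad: "E * card (Bad z) \<le> card (PiE Z S)" if "z \<in> G" for z
  proof -
    obtain x b where z: "z = (x, b)" "x \<in> Z" "E * card (V x b) \<le> card (S x)"
      using \<open>z \<in> G\<close> by (auto simp: G_def)
    have "card (Bad z) = (\<Prod>x'\<in>Z. card ((S(x := V x b)) x'))"
      unfolding Bad_def z using Z(1) by (simp only: card_PiE fst_conv snd_conv)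
    also have "\<dots> = card (V x b) * (\<Prod>x'\<in>Z - {x}. card (S x'))"
      using Z(1) z(2) by (subst prod.remove[of _ x]) (auto intro!: prod.cong)
    finally have "E * card (Bad z) = E * card (V x b) * (\<Prod>x'\<in>Z - {x}. card (S x'))" by simp
    also have "\<dots> \<le> card (S x) * (\<Prod>x'\<in>Z - {x}. card (S x'))" using z(3) by (rule mult_right_mono) simp
    also have "\<dots> = card (PiE Z S)" using Z(1) z(2) by (simp add: card_PiE prod.remove)
    finally show ?thesis .
  qed
  have pos: "0 < card (PiE Z S)"
    using h(2) Z(1) finS unfolding acc by (simp add: card_gt_0_iff finite_PiE)
  \<comment> \<open>Planted vectors make up at least 1/(2 (2J+4)^M) of the accepted ones, with
    \<open>M = card Z\<close>, whereas the at most 2M sets \<open>Bad z\<close> together make up at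
    most 2M/E, which is smaller.\<close>
  have "\<not> ?P \<subseteq> (\<Union>z\<in>G. Bad z)"
  proof
    assume "?P \<subseteq> (\<Union>z\<in>G. Bad z)"
    then have "card ?P \<le> card (\<Union>z\<in>G. Bad z)"
      using finG finS Z(1) by (intro card_mono finite_UN_I) (auto simp: Bad_def intro!: finite_PiE)
    also have "\<dots> \<le> (\<Sum>z\<in>G. card (Bad z))" using finG by (rule card_UN_le)
    finally have "E * card ?P \<le> (\<Sum>z\<in>G. E * card (Bad z))"
      by (simp add: sum_distrib_left[symmetric])
    also have "\<dots> \<le> (\<Sum>z\<in>G. card (PiE Z S))" using EBad by (rule sum_mono)
    also have "\<dots> \<le> 2 * ?M * card (PiE Z S)" using cG by simp
    finally have *: "E * card ?P \<le> 2 * ?M * card (PiE Z S)" .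
    have "E * card (PiE Z S) \<le> E * (2 * (2*J+4) ^ ?M * card ?P)"
      using h(3) unfolding acc by (rule mult_left_mono) simp
    also have "\<dots> = 2 * (2*J+4) ^ ?M * (E * card ?P)" by (simp only: ac_simps)
    also have "\<dots> \<le> 2 * (2*J+4) ^ ?M * (2 * ?M * card (PiE Z S))" using * by (rule mult_left_mono) simp
    also have "\<dots> = (4 * ?M * (2*J+4) ^ ?M) * card (PiE Z S)" by simp
    finally show False using E pos by simp
  qed
  then obtain \<rho> y where \<rho>: "\<rho> \<in> ?\<Psi>" "g \<rho> h = Some y" "planted Z W h y" "\<And>z. z \<in> G \<Longrightarrow> \<rho> \<notin> Bad z"
    by blast
  then obtain w where w: "w \<in> W" "\<And>x. x \<in> Z \<Longrightarrow> y x = (w \<in> h x)" unfolding planted_def by blast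
  have y: "f x (\<rho> x) h = Some (y x)" if "x \<in> Z" for x
    using \<rho>(2) that by (auto simp: g_def split: if_splits)
  have "(w \<in> h x) = b" if x: "x \<in> Z" and "E * card (V x b) \<le> card (S x)" for x b
  proof (rule ccontr)
    assume neq: "(w \<in> h x) \<noteq> b"
    have "(x, b) \<in> G" using that by (simp add: G_def)
    then have "\<rho> \<notin> Bad (x, b)" by (rule \<rho>(4))
    moreover have "\<rho> x' \<in> (S(x := V x b)) x'" if "x' \<in> Z" for x'
      using neq y[OF that] w(2)[OF that] \<rho>(1) that by (auto simp: S_def V_def PiE_iff)
    ultimately show False using \<rho>(1) by (simp add: Bad_def PiE_iff)
  qed
  then show ?thesis using h(1) w(1) unfolding S_def V_def by blast
qed

section \<open>Queries split the oracles into rectangles\<close>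

lemma mle_cong:
  assumes "\<And>b. length b = m \<Longrightarrow> A b = A' b"
  shows "mle F A m = mle F A' m"
proof -
  have "is_mle F A m = is_mle F A' m" using assms by (auto simp: is_mle_def fun_eq_iff)
  then show ?thesis unfolding mle_def by simp
qed

context cring
begin

lemma monomial_closed:
  assumes "z \<in> field_points R m" "S \<subseteq> {..<m}"
  shows "finprod R (\<lambda>i. z ! i) S \<in> carrier R"
proof (rule finprod_closed)
  show "(\<lambda>i. z ! i) \<in> S \<rightarrow> carrier R"
  proof
    fix i assume "i \<in> S"
    then have "i < length z" using assms by (auto simp: field_points_def)
    then have "z ! i \<in> set z" by (rule nth_mem)
    then show "z ! i \<in> carrier R" using assms(1) by (auto simp: field_points_def)
  qed
qed

lemma mle_multilinear:
  obtains c where "c \<in> Pow {..<m} \<rightarrow> carrier R"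
    "\<And>z. z \<in> field_points R m \<Longrightarrow>
       mle R A m z = finsum R (\<lambda>S. c S \<otimes> finprod R (\<lambda>i. z ! i) S) (Pow {..<m})"
  using is_mle_mle[of A m] unfolding is_mle_def multilinear_def by blast

lemma mle_closed:
  assumes "z \<in> field_points R m"
  shows "mle R A m z \<in> carrier R"
proof -
  obtain c where c: "c \<in> Pow {..<m} \<rightarrow> carrier R" "\<And>z. z \<in> field_points R m \<Longrightarrow>
       mle R A m z = finsum R (\<lambda>S. c S \<otimes> finprod R (\<lambda>i. z ! i) S) (Pow {..<m})"
    using mle_multilinear[of m A] by blast
  have "(\<lambda>S. c S \<otimes> finprod R (\<lambda>i. z ! i) S) \<in> Pow {..<m} \<rightarrow> carrier R"
  proof
    fix S assume "S \<in> Pow {..<m}"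
    then show "c S \<otimes> finprod R (\<lambda>i. z ! i) S \<in> carrier R"
      using c(1) monomial_closed[OF assms, of S] by (intro m_closed) (auto simp: Pi_iff)
  qed
  then show ?thesis unfolding c(2)[OF assms] by (rule finsum_closed)
qed

lemma mle_empty:
  assumes "z \<in> field_points R m"
  shows "mle R (\<lambda>_. False) m z = \<zero>"
proof -
  have "is_mle R (\<lambda>_. False) m (\<lambda>z\<in>field_points R m. \<zero>)"
    unfolding is_mle_def
  proof (intro conjI allI impI)
    show "multilinear R m (\<lambda>z\<in>field_points R m. \<zero>)"
      unfolding multilinear_def
    proof (intro bexI[of _ "\<lambda>_. \<zero>"] ballI)
      fix z assume z: "z \<in> field_points R m"
      have "finsum R (\<lambda>S. \<zero> \<otimes> finprod R (\<lambda>i. z ! i) S) (Pow {..<m}) = finsum R (\<lambda>_. \<zero>) (Pow {..<m})"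
        using monomial_closed[OF z] by (intro add.finprod_cong') auto
      then show "(\<lambda>z\<in>field_points R m. \<zero>) z = finsum R (\<lambda>S. \<zero> \<otimes> finprod R (\<lambda>i. z ! i) S) (Pow {..<m})"
        using z by (simp add: finsum_zero)
    qed auto
    show "(\<lambda>z\<in>field_points R m. \<zero>) (map (of_bit R) b) = of_bit R False" if "length b = m" for b
      using of_bit_points[OF that] by (simp add: of_bit_def)
  qed auto
  then show ?thesis using assms mle_unique by fastforce
qed

text \<open>The sum of the two extensions is multilinear, so by uniqueness only Boolean points need
  checking. There disjointness prevents adding one to one.\<close>

lemma mle_disjoint:
  assumes disj: "\<And>b. \<not> (A b \<and> A' b)" and z: "z \<in> field_points R m"
  shows "mle R (\<lambda>b. A b \<or> A' b) m z = mle R A m z \<oplus> mle R A' m z"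
proof -
  let ?g = "\<lambda>z\<in>field_points R m. mle R A m z \<oplus> mle R A' m z"
  have "is_mle R (\<lambda>b. A b \<or> A' b) m ?g"
    unfolding is_mle_def
  proof (intro conjI allI impI)
    obtain c where c: "c \<in> Pow {..<m} \<rightarrow> carrier R" "\<And>z. z \<in> field_points R m \<Longrightarrow>
         mle R A m z = finsum R (\<lambda>S. c S \<otimes> finprod R (\<lambda>i. z ! i) S) (Pow {..<m})"
      using mle_multilinear[of m A] by blast
    obtain d where d: "d \<in> Pow {..<m} \<rightarrow> carrier R" "\<And>z. z \<in> field_points R m \<Longrightarrow>
         mle R A' m z = finsum R (\<lambda>S. d S \<otimes> finprod R (\<lambda>i. z ! i) S) (Pow {..<m})"
      using mle_multilinear[of m A'] by blast
    show "multilinear R m ?g"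
      unfolding multilinear_def
    proof (intro bexI[of _ "\<lambda>S. c S \<oplus> d S"] ballI)
      fix z assume z: "z \<in> field_points R m"
      let ?x = "\<lambda>S. finprod R (\<lambda>i. z ! i) S"
      have cl: "c S \<in> carrier R" "d S \<in> carrier R" "?x S \<in> carrier R" if "S \<in> Pow {..<m}" for S
        using c(1) d(1) monomial_closed[OF z] that by (auto simp: Pi_iff)
      have "finsum R (\<lambda>S. (c S \<oplus> d S) \<otimes> ?x S) (Pow {..<m})
          = finsum R (\<lambda>S. c S \<otimes> ?x S \<oplus> d S \<otimes> ?x S) (Pow {..<m})"
      proof (rule add.finprod_cong'[OF refl])
        show "(\<lambda>S. c S \<otimes> ?x S \<oplus> d S \<otimes> ?x S) \<in> Pow {..<m} \<rightarrow> carrier R"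
          by (rule funcsetI) (intro a_closed m_closed cl)
        show "(c S \<oplus> d S) \<otimes> ?x S = c S \<otimes> ?x S \<oplus> d S \<otimes> ?x S" if "S \<in> Pow {..<m}" for S
          using cl[OF that] by (rule l_distr)
      qed
      also have "\<dots> = finsum R (\<lambda>S. c S \<otimes> ?x S) (Pow {..<m}) \<oplus> finsum R (\<lambda>S. d S \<otimes> ?x S) (Pow {..<m})"
        by (rule add.finprod_multf; rule funcsetI; intro m_closed cl)
      finally show "?g z = finsum R (\<lambda>S. (c S \<oplus> d S) \<otimes> ?x S) (Pow {..<m})"
        using z c(2)[OF z] d(2)[OF z] by simp
    next
      show "(\<lambda>S. c S \<oplus> d S) \<in> Pow {..<m} \<rightarrow> carrier R"
        using c(1) d(1) by (auto simp: Pi_iff)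
    qed
  next
    fix b :: "bool list" assume b: "length b = m"
    have "mle R A m (map (of_bit R) b) = of_bit R (A b)" "mle R A' m (map (of_bit R) b) = of_bit R (A' b)"
      using is_mle_mle[of A m] is_mle_mle[of A' m] b unfolding is_mle_def by blast+
    then show "?g (map (of_bit R) b) = of_bit R (A b \<or> A' b)"
      using of_bit_points[OF b] disj[of b] by (auto simp: of_bit_def)
  qed auto
  then show ?thesis using z mle_unique by fastforce
qed

text \<open>Used with \<kappa> the prefix of a string, so that each summand depends on a single
  column.\<close>

lemma mle_eq_finsum:
  assumes "finite Y" and z: "z \<in> field_points R m"
  shows "mle R (\<lambda>b. A b \<and> \<kappa> b \<in> Y) m z = finsum R (\<lambda>y. mle R (\<lambda>b. A b \<and> \<kappa> b = y) m z) Y"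
  using assms(1)
proof induction
  case empty
  then show ?case using mle_empty[OF z] by simp
next
  case (insert y Y)
  have "mle R (\<lambda>b. A b \<and> \<kappa> b \<in> insert y Y) m z
      = mle R (\<lambda>b. (A b \<and> \<kappa> b = y) \<or> (A b \<and> \<kappa> b \<in> Y)) m z"
    by (rule fun_cong[OF mle_cong]) auto
  also have "\<dots> = mle R (\<lambda>b. A b \<and> \<kappa> b = y) m z \<oplus> mle R (\<lambda>b. A b \<and> \<kappa> b \<in> Y) m z"
    using insert.hyps z by (intro mle_disjoint) auto
  also have "\<dots> = finsum R (\<lambda>y. mle R (\<lambda>b. A b \<and> \<kappa> b = y) m z) (insert y Y)"
    unfolding insert.IH using insert.hyps mle_closed[OF z] by (intro finsum_insert[symmetric]) auto
  finally show ?case .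
qed

end

section \<open>Oracles with a planted matrix: prefixes are columns, suffixes are rows\<close>

definition plant :: "bool_oracle \<Rightarrow> nat \<Rightarrow> nat \<Rightarrow> (bool list \<Rightarrow> bool list set) \<Rightarrow> bool_oracle" where
  "plant A n m h b = (if length b = m then drop n b \<in> h (take n b) else A b)"

abbreviation strings :: "nat \<Rightarrow> bool list set" where
  "strings n \<equiv> {x. length x = n}"

lemma finite_strings: "finite (strings n)"
  using finite_lists_length_eq[of "UNIV :: bool set" n] by simp

lemma card_strings: "card (strings n) = 2 ^ n"
  using card_lists_length_eq[of "UNIV :: bool set" n] by simp

text \<open>By additivity the value is a sum over the columns of field elements, each depending on
  its own column only. Taking the tuple of summands as label gives rectangles, and there is one
  field element per column. In a dimension other than \<open>m\<close> the planted matrix is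
  invisible.\<close>

lemma protocol_mle:
  fixes F (structure)
  assumes "cring F" and fin: "finite (carrier F)" and nm: "n \<le> m" and z: "z \<in> field_points F m'"
  shows "protocol (strings n) (Pow W) (card (carrier F) ^ card (strings n)) (\<lambda>h. mle F (plant A n m h) m' z)"
proof (cases "m' = m")
  case False
  have "mle F (plant A n m h) m' = mle F A m'" for h
    using False by (intro mle_cong) (simp add: plant_def)
  moreover have "1 \<le> card (carrier F)"
    using fin cring.cring_simprules(2)[OF assms(1)] by (simp add: Suc_le_eq card_gt_0_iff) blast
  ultimately show ?thesis by (simp only:) (rule protocol_const, simp)
next
  case True
  interpret cring F by fact
  let ?X = "strings n"
  define \<mu> where "\<mu> x c = mle F (\<lambda>b. drop n b \<in> c \<and> take n b = x) m z" for x c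
  define \<sigma> where "\<sigma> h = (\<lambda>x\<in>?X. \<mu> x (h x))" for h
  let ?U = "PiE ?X (\<lambda>_. Pow W)"
  have sub: "\<sigma> ` ?U \<subseteq> PiE ?X (\<lambda>_. carrier F)"
    using mle_closed z True by (auto simp: \<sigma>_def \<mu>_def)
  have finP: "finite (PiE ?X (\<lambda>_. carrier F))" using fin finite_strings by (intro finite_PiE) auto
  have "rect_label ?X (Pow W) (card (carrier F) ^ card ?X) \<sigma>"
    unfolding rect_label_def
  proof (intro conjI ballI)
    show "finite (\<sigma> ` ?U)" using sub finP by (rule finite_subset)
    show "card (\<sigma> ` ?U) \<le> card (carrier F) ^ card ?X"
      using card_mono[OF finP sub] finite_strings by (simp add: card_PiE)
    fix t assume "t \<in> \<sigma> ` ?U"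
    then obtain h0 where t: "t = \<sigma> h0" by blast
    have "\<sigma> h = t \<longleftrightarrow> (\<forall>x\<in>?X. h x \<in> {c. \<mu> x c = t x})" for h
      unfolding t \<sigma>_def by (auto simp: fun_eq_iff restrict_def)
    then show "\<exists>F. \<forall>h\<in>?U. \<sigma> h = t \<longleftrightarrow> (\<forall>x\<in>?X. h x \<in> F x)"
      by (intro exI[of _ "\<lambda>x. {c. \<mu> x c = t x}"] ballI)
  qed
  then show ?thesis
  proof (rule protocolI)
    have "mle F (plant A n m h) m' z = finsum F (\<sigma> h) ?X" for h
    proof -
      have "mle F (plant A n m h) m' z = mle F (\<lambda>b. plant A n m h b \<and> take n b \<in> ?X) m z"
        unfolding True using nm by (intro fun_cong[OF mle_cong]) auto
      also have "\<dots> = finsum F (\<lambda>x. mle F (\<lambda>b. plant A n m h b \<and> take n b = x) m z) ?X"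
        using z True by (intro mle_eq_finsum finite_strings) auto
      also have "\<dots> = finsum F (\<sigma> h) ?X"
      proof (rule add.finprod_cong'[OF refl])
        show "\<sigma> h \<in> ?X \<rightarrow> carrier F"
          using mle_closed z True by (auto simp: \<sigma>_def \<mu>_def)
        fix x assume "x \<in> ?X"
        then show "mle F (\<lambda>b. plant A n m h b \<and> take n b = x) m z = \<sigma> h x"
          unfolding \<sigma>_def \<mu>_def by (simp only: restrict_apply if_True)
            (intro fun_cong[OF mle_cong], auto simp: plant_def)
      qed
      finally show ?thesis .
    qed
    then show "determines ?X (Pow W) \<sigma> (\<lambda>h. mle F (plant A n m h) m' z)"
      unfolding determines_def by simp
  qed
qed

section \<open>Sizes of queries and replies\<close>

lemma blocks_nonempty [simp]: "blocks q \<noteq> []"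
  by (induction q rule: blocks.induct) auto

text \<open>Every block is charged together with its separator; the last one has none, whence
  \<open>Suc\<close>. Blanks only add slack.\<close>

lemma length_blocks: "sum_list (map length (blocks q)) + length (blocks q) \<le> Suc (length q)"
proof (induction q rule: blocks.induct)
  case (2 b w)
  then show ?case by (cases "blocks w") auto
qed auto

lemma length_chunks [simp]: "length (chunks k m xs) = m"
  by (induction k m xs rule: chunks.induct) auto

lemma chunks_elem: "ys \<in> set (chunks k m xs) \<Longrightarrow> k * m \<le> length xs \<Longrightarrow> length ys = k \<and> set ys \<subseteq> set xs"
proof (induction k m xs rule: chunks.induct)
  case (2 k m xs)
  then show ?case using set_take_subset[of k xs] set_drop_subset[of k xs] by fastforce
qed auto

lemma bits_to_int_less: "bits_to_int bs < 2 ^ length bs"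
  by (induction bs) (auto simp: of_bool_def)

text \<open>The parse of a query word does not involve the oracle, so field, dimension and point are
  fixed before \<open>A\<close> is. The bounds on \<open>w\<close> and \<open>p\<close> limit both
  the size of the field and the length of the reply.\<close>

lemma query_reply_cases:
  obtains "\<And>A. query_reply A q = []"
  | w p f m z where "presents_field p f" "z \<in> field_points (presented_field p f) m" "m \<le> length q"
      "\<And>A. query_reply A q = concat (map (\<lambda>c. map Bit (int_to_bits w c) @ [Sep])
               (elem_coeffs p f (mle (presented_field p f) A m z)))"
      "Suc w * degree f \<le> length q" "p < 2 ^ w"
proof -
  define bp where "bp = hd (blocks q)"
  define bf where "bf = takeWhile (\<lambda>b. b \<noteq> []) (tl (blocks q))"
  define bz where "bz = tl (dropWhile (\<lambda>b. b \<noteq> []) (tl (blocks q)))"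
  define w where "w = length bp"
  define p where "p = bits_to_int bp"
  define f where "f = map bits_to_int bf"
  define cs where "cs = map bits_to_int bz"
  define k where "k = degree f"
  define m where "m = length cs div k"
  define z where "z = map (field_elem p f) (chunks k m cs)"
  let ?ok = "(\<forall>b \<in> set (bf @ bz). length b = w) \<and> presents_field p f \<and>
           k dvd length cs \<and> set cs \<subseteq> {0..<p}"
  have reply: "query_reply A q = (if ?ok then concat (map (\<lambda>c. map Bit (int_to_bits w c) @ [Sep])
               (elem_coeffs p f (mle (presented_field p f) A m z))) else [])" for A
    unfolding query_reply_def Let_def bp_def bf_def bz_def w_def p_def f_def cs_def k_def m_def z_def ..
  show thesis
  proof (cases ?ok)
    case False
    have "query_reply A q = []" for A unfolding reply using False by (rule if_not_P)
    then show thesis by (rule that(1))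
  next
    case True
    have split: "blocks q = bp # bf @ dropWhile (\<lambda>b. b \<noteq> []) (tl (blocks q))"
      unfolding bp_def bf_def by simp
    have len_bz: "length bz \<le> length (dropWhile (\<lambda>b. b \<noteq> []) (tl (blocks q)))"
      unfolding bz_def by simp
    have "sum_list (map length bf) = length bf * w"
      using True by (induction bf) auto
    moreover have "w + sum_list (map length bf) + Suc (length bf + length bz) \<le> Suc (length q)"
      using length_blocks[of q] len_bz by (subst (asm) (1 2) split) (simp add: w_def)
    ultimately have len: "length bf * Suc w \<le> length q" "length bz \<le> length q" by simp_all
    have "k \<le> length bf" unfolding k_def f_def by simp
    then have "k * Suc w \<le> length q" using len(1) mult_le_mono1 le_trans by blast
    moreover have "m \<le> length q"
      unfolding m_def by (rule order.trans[OF div_le_dividend]) (simp add: cs_def len(2))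
    moreover have "z \<in> field_points (presented_field p f) m"
    proof -
      have "field_elem p f ys \<in> carrier (presented_field p f)" if "ys \<in> set (chunks k m cs)" for ys
      proof -
        have "length ys = k \<and> set ys \<subseteq> set cs"
          by (rule chunks_elem[OF that]) (simp add: m_def)
        then have "ys \<in> coeff_vectors p (degree f)" using True by (auto simp: coeff_vectors_def k_def)
        then show ?thesis using bij_betw_field_elem[of p f] True by (blast dest: bij_betwE)
      qed
      then show ?thesis by (auto simp: field_points_def z_def)
    qed
    moreover have "p < 2 ^ w" unfolding p_def w_def by (rule bits_to_int_less)
    moreover have "presents_field p f" using True by blast
    moreover have "query_reply A q = concat (map (\<lambda>c. map Bit (int_to_bits w c) @ [Sep])
               (elem_coeffs p f (mle (presented_field p f) A m z)))" for A
      unfolding reply using True by (rule if_P)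
    ultimately show thesis by (intro that(2)[of p f z m w]) (simp_all only: k_def mult.commute)
  qed
qed

lemma card_presented_field:
  assumes "presents_field p f"
  shows "card (carrier (presented_field p f)) = nat p ^ degree f"
    "finite (carrier (presented_field p f))"
proof -
  have "coeff_vectors p (degree f) = {cs. set cs \<subseteq> {0..<p} \<and> length cs = degree f}"
    unfolding coeff_vectors_def by auto
  then have "finite (coeff_vectors p (degree f))" "card (coeff_vectors p (degree f)) = nat p ^ degree f"
    by (simp_all add: finite_lists_length_eq card_lists_length_eq)
  then show "card (carrier (presented_field p f)) = nat p ^ degree f"
    "finite (carrier (presented_field p f))"
    using bij_betw_field_elem[OF assms] by (auto simp: bij_betw_same_card[symmetric] bij_betw_finite)
qed

lemma elem_coeffs_length:
  assumes "presents_field p f" "a \<in> carrier (presented_field p f)"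
  shows "length (elem_coeffs p f a) = degree f"
proof -
  have bij: "bij_betw (field_elem p f) (coeff_vectors p (degree f)) (carrier (presented_field p f))"
    by (rule bij_betw_field_elem[OF assms(1)])
  have "a \<in> field_elem p f ` coeff_vectors p (degree f)"
    using bij_betw_imp_surj_on[OF bij] assms(2) by simp
  then obtain cs where cs: "a = field_elem p f cs" "cs \<in> coeff_vectors p (degree f)" by (rule imageE)
  have "elem_coeffs p f a = cs"
    unfolding elem_coeffs_def
  proof (rule the_equality)
    fix cs' assume "cs' \<in> coeff_vectors p (degree f) \<and> field_elem p f cs' = a"
    then show "cs' = cs" using inj_onD[OF bij_betw_imp_inj_on[OF bij], of cs' cs] cs by simp
  qed (use cs in simp)
  then show ?thesis using cs(2) by (simp add: coeff_vectors_def)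
qed

text \<open>A coefficient takes \<open>w\<close> bits and a separator, as it does in the query.
  Hence the query tape never grows by asking.\<close>

lemma length_query_reply: "length (query_reply A q) \<le> length q"
proof (rule query_reply_cases[of q])
  fix w p f m z
  assume a: "presents_field p f" "z \<in> field_points (presented_field p f) m"
    "\<And>A. query_reply A q = concat (map (\<lambda>c. map Bit (int_to_bits w c) @ [Sep])
               (elem_coeffs p f (mle (presented_field p f) A m z)))"
    "Suc w * degree f \<le> length q"
  interpret field "presented_field p f" by (rule field_presented_field[OF a(1)])
  have "length (concat (map (\<lambda>c. map Bit (int_to_bits w c) @ [Sep]) cs)) = Suc w * length cs" for cs
    by (induction cs) (simp_all add: int_to_bits_def)
  then show ?thesis using a(3,4) elem_coeffs_length[OF a(1) mle_closed[OF a(2)]] by simp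
qed simp

lemma query_reply_cong:
  assumes "\<And>b. length b \<le> length q \<Longrightarrow> A b = A' b"
  shows "query_reply A q = query_reply A' q"
proof (rule query_reply_cases[of q])
  fix w p f m z
  assume a: "m \<le> length q" "\<And>A. query_reply A q = concat (map (\<lambda>c. map Bit (int_to_bits w c) @ [Sep])
               (elem_coeffs p f (mle (presented_field p f) A m z)))"
  have "mle (presented_field p f) A m = mle (presented_field p f) A' m"
    using a(1) assms by (intro mle_cong) simp
  then show ?thesis by (simp add: a(2))
qed simp

text \<open>The field has at most \<open>2 ^ length q\<close> elements, and
  \<open>protocol_mle\<close> pays for one element in each of the \<open>2 ^ n\<close>
  columns.\<close>

lemma protocol_query_reply:
  assumes "n \<le> m"
  shows "protocol (strings n) (Pow W) (2 ^ (2 ^ n * length q)) (\<lambda>h. query_reply (plant A n m h) q)"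
proof (rule query_reply_cases[of q])
  assume "\<And>A. query_reply A q = []"
  then show ?thesis by (simp add: protocol_const)
next
  fix w p f m' z
  let ?F = "presented_field p f"
  assume a: "presents_field p f" "z \<in> field_points ?F m'"
    "\<And>A. query_reply A q = concat (map (\<lambda>c. map Bit (int_to_bits w c) @ [Sep])
               (elem_coeffs p f (mle ?F A m' z)))"
    "Suc w * degree f \<le> length q" "p < 2 ^ w"
  interpret field ?F by (rule field_presented_field[OF a(1)])
  have "nat p \<le> 2 ^ w" using a(5) by (simp add: nat_le_iff)
  then have "card (carrier ?F) \<le> (2 ^ w) ^ degree f"
    unfolding card_presented_field(1)[OF a(1)] by (rule power_mono) simp
  also have "\<dots> \<le> 2 ^ length q"
    using a(4) by (simp flip: power_mult)
  finally have "card (carrier ?F) ^ card (strings n) \<le> (2 ^ length q) ^ card (strings n)"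
    by (rule power_mono) simp
  also have "\<dots> = 2 ^ (2 ^ n * length q)" by (simp add: card_strings mult.commute flip: power_mult)
  finally have le: "card (carrier ?F) ^ card (strings n) \<le> 2 ^ (2 ^ n * length q)" .
  have "protocol (strings n) (Pow W) (2 ^ (2 ^ n * length q)) (\<lambda>h. mle ?F (plant A n m h) m' z)"
    by (rule protocol_mono[OF protocol_mle[OF _ card_presented_field(2)[OF a(1)] assms a(2)] le])
      (rule is_cring)
  then show ?thesis
    by (rule protocol_comp) (simp add: determines_def a(3))
qed

section \<open>Computations as protocols\<close>

fun query_tape_size :: "tape list \<Rightarrow> nat" where
  "query_tape_size [] = 0"
| "query_tape_size ((l, r) # ts) = length l + length r"

text \<open>Writing on an empty right half and moving left off an empty left half each create one
  cell.\<close>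

lemma query_tape_size_step:
  "query_tape_size (map2 (\<lambda>(s, d) tp. move d (write_sym s tp)) acts ts) \<le> query_tape_size ts + 2"
proof -
  have step: "query_tape_size (move d (write_sym s (l, r)) # ts') \<le> length l + length r + 2" for s d l r ts'
    by (cases d; cases l) auto
  show ?thesis
  proof (cases "ts = [] \<or> acts = []")
    case False
    then obtain s d acts' l r ts' where "acts = (s, d) # acts'" "ts = (l, r) # ts'"
      by (metis list.exhaust surj_pair)
    then show ?thesis using step[of d s l r] by simp
  qed auto
qed

lemma query_tape_size_answer:
  "query_tape_size (answer_query A ts) \<le> query_tape_size ts"
proof (cases ts)
  case (Cons t ts')
  obtain l r where t: "t = (l, r)" by (cases t)
  have "length (takeWhile (\<lambda>s. s \<noteq> Blank) r) \<le> length r" by (rule length_takeWhile_le)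
  then show ?thesis using Cons t length_query_reply[of A "takeWhile (\<lambda>s. s \<noteq> Blank) r"] by simp
qed simp

text \<open>A query word fits on the query tape, which gains at most two cells per step, and the
  dimension queried is at most the length of the word.\<close>

lemma exec_cong:
  assumes "\<And>b. length b \<le> query_tape_size ts + 2 * t \<Longrightarrow> A b = A' b"
  shows "exec A M t (q, ts) = exec A' M t (q, ts)"
  using assms
proof (induction t arbitrary: q ts)
  case (Suc t)
  have "answer_query A ts = answer_query A' ts"
  proof (cases ts)
    case (Cons tp ts')
    obtain l r where tp: "tp = (l, r)" by (cases tp)
    have "length (takeWhile (\<lambda>s. s \<noteq> Blank) r) \<le> length r" by (rule length_takeWhile_le)
    then show ?thesis using Suc.prems Cons tp by (simp, intro query_reply_cong) simp
  qed simp
  moreover have "exec A M t (q', answer_query A' ts) = exec A' M t (q', answer_query A' ts)" for q'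
    using query_tape_size_answer[of A' ts] Suc.prems by (intro Suc.IH) simp
  moreover have "exec A M t (q', map2 (\<lambda>(s, d) tp. move d (write_sym s tp)) acts ts)
      = exec A' M t (q', map2 (\<lambda>(s, d) tp. move d (write_sym s tp)) acts ts)" for q' acts
    using query_tape_size_step[of acts ts] Suc.prems by (intro Suc.IH) simp
  ultimately show ?case by (simp split: option.splits action.splits)
qed simp

text \<open>A step asks at most one query, of length at most \<open>T\<close>, for a factor of
  2^(2^n T); \<open>protocol_bind\<close> takes care of later steps depending on earlier replies.
  The bound \<open>T\<close> is kept along the run, since a step lowers \<open>2 * t\<close> by two
  and adds at most two cells.\<close>

lemma protocol_exec:
  assumes "n \<le> m" and "query_tape_size ts + 2 * t \<le> T"
  shows "protocol (strings n) (Pow W) (2 ^ (t * (2 ^ n * T))) (\<lambda>h. exec (plant A n m h) M t (q, ts))"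
  using assms(2)
proof (induction t arbitrary: q ts)
  case 0
  show ?case by (simp add: protocol_const)
next
  case (Suc t)
  let ?k = "2 ^ (2 ^ n * T) :: nat" and ?l = "2 ^ (t * (2 ^ n * T)) :: nat"
  have kl: "2 ^ (Suc t * (2 ^ n * T)) = ?k * ?l" by (simp add: power_add)
  show ?case
  proof (cases "map_of (program M) (q, map scan ts)")
    case None
    then show ?thesis by (simp add: protocol_const)
  next
    case (Some a)
    show ?thesis
    proof (cases a)
      case (Halt b)
      then show ?thesis using Some by (simp add: protocol_const)
    next
      case (Step q' acts)
      have "protocol (strings n) (Pow W) ?l (\<lambda>h. exec (plant A n m h) M t
          (q', map2 (\<lambda>(s, d) tp. move d (write_sym s tp)) acts ts))"
        using query_tape_size_step[of acts ts] Suc.prems by (intro Suc.IH) simp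
      then have "protocol (strings n) (Pow W) (?k * ?l) (\<lambda>h. exec (plant A n m h) M t
          (q', map2 (\<lambda>(s, d) tp. move d (write_sym s tp)) acts ts))"
        by (rule protocol_mono) simp
      then show ?thesis unfolding kl using Some Step by simp
    next
      case (Query q')
      have "protocol (strings n) (Pow W) ?k (\<lambda>h. answer_query (plant A n m h) ts)"
      proof (cases ts)
        case Nil
        then show ?thesis by (simp add: protocol_const)
      next
        case (Cons tp ts')
        obtain l r where tp: "tp = (l, r)" by (cases tp)
        let ?q = "takeWhile (\<lambda>s. s \<noteq> Blank) r"
        have "length ?q \<le> T"
          using length_takeWhile_le[of "\<lambda>s. s \<noteq> Blank" r] Suc.prems Cons tp by simp
        then have "protocol (strings n) (Pow W) ?k (\<lambda>h. query_reply (plant A n m h) ?q)"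
          by (intro protocol_mono[OF protocol_query_reply[OF assms(1)]] power_increasing mult_left_mono) auto
        then show ?thesis by (rule protocol_comp) (simp add: determines_def Cons tp)
      qed
      then have "protocol (strings n) (Pow W) (?k * ?l)
          (\<lambda>h. (\<lambda>ts' h. exec (plant A n m h) M t (q', ts')) (answer_query (plant A n m h) ts) h)"
      proof (rule protocol_bind)
        fix ts' assume "ts' \<in> (\<lambda>h. answer_query (plant A n m h) ts) ` PiE (strings n) (\<lambda>_. Pow W)"
        then have "query_tape_size ts' \<le> query_tape_size ts" using query_tape_size_answer by auto
        then show "protocol (strings n) (Pow W) ?l (\<lambda>h. exec (plant A n m h) M t (q', ts'))"
          using Suc.prems by (intro Suc.IH) simp
      qed
      then show ?thesis unfolding kl using Some Query by simp
    qed
  qed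
qed

lemma query_tape_size_start: "query_tape_size (snd (start M inputs)) = 0"
  by (simp add: start_def)

lemma exec_mono: "exec A M t c = Some b \<Longrightarrow> t \<le> t' \<Longrightarrow> exec A M t' c = Some b"
proof (induction t arbitrary: c t')
  case 0
  then show ?case by (cases c) simp
next
  case (Suc t)
  obtain t'' where t': "t' = Suc t''" "t \<le> t''" using Suc.prems(2) by (cases t') auto
  obtain q ts where c: "c = (q, ts)" by (cases c)
  show ?case using Suc.prems(1) Suc.IH[OF _ t'(2)] unfolding t'(1) c
    by (auto split: option.splits action.splits)
qed

lemma accepts_iff_exec:
  assumes "halts_within A M inputs t"
  shows "accepts A M inputs \<longleftrightarrow> exec A M t (start M inputs) = Some True"
proof
  assume "accepts A M inputs"
  then obtain t' where t': "exec A M t' (start M inputs) = Some True" unfolding accepts_def by blast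
  obtain b where b: "exec A M t (start M inputs) = Some b"
    using assms unfolding halts_within_def by blast
  show "exec A M t (start M inputs) = Some True"
    using exec_mono[OF t'] exec_mono[OF b] b t' by (metis nat_le_linear)
qed (auto simp: accepts_def)

section \<open>Planting the answers of a machine\<close>

lemma square_less_power2: "5 \<le> n \<Longrightarrow> n * n < (2 :: nat) ^ n"
proof (induction n rule: nat_induct_at_least)
  case (Suc n)
  have "3 * n \<le> n * n" using Suc.hyps by (intro mult_le_mono1) simp
  moreover have "Suc n * Suc n = n * n + 2 * n + 1" by simp
  ultimately have "Suc n * Suc n \<le> n * n + n * n" using Suc.hyps by linarith
  then show ?case using Suc.IH by simp
qed simp

lemma mult_power2_bound:
  assumes "x \<le> 2 ^ (i * n)" "y \<le> 2 ^ (j * n)"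
  shows "x * y \<le> (2 :: nat) ^ ((i + j) * n)"
  using mult_mono[OF assms] by (simp add: add_mult_distrib power_add)

lemma add_power2_bound:
  assumes "x \<le> 2 ^ (i * n)" "y \<le> 2 ^ (j * n)" "i \<le> k" "j \<le> k" "1 \<le> n"
  shows "x + y \<le> (2 :: nat) ^ ((k + 1) * n)"
proof -
  have "x \<le> 2 ^ (k * n)" "y \<le> 2 ^ (k * n)"
    using assms by (auto elim!: order.trans intro!: power_increasing)
  then have "x + y \<le> 2 * 2 ^ (k * n)" by simp
  also have "\<dots> \<le> 2 ^ n * 2 ^ (k * n)"
    using assms(5) power_increasing[of 1 n "2 :: nat"] by (intro mult_right_mono) auto
  finally show ?thesis by (simp add: power_add)
qed

lemma exp_bound_le: "1 \<le> n \<Longrightarrow> exp_bound c n \<le> 2 ^ (2 * c * n)"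
  unfolding exp_bound_def by (intro power_increasing) (auto simp: mult.commute mult_le_mono)

text \<open>\<open>planting\<close> with concrete parameters: \<open>2 ^ n\<close> columns, strings
  of length \<open>m\<close> linear in \<open>n\<close>, and an error ratio of 2^-(2^(2n)). All
  costs may be exponential in \<open>n\<close>, because \<open>s\<close> and \<open>d\<close> enter
  \<open>J\<close> linearly and \<open>a\<close> absorbs them.\<close>

lemma plant_correct:
  fixes f :: "bool list \<Rightarrow> 's \<Rightarrow> bool_oracle \<Rightarrow> bool option"
  assumes n: "a + 6 \<le> n" and sd: "s + d + 2 \<le> 2 ^ (a * n)"
    and \<Omega>: "finite \<Omega>" "\<Omega>' \<subseteq> \<Omega>" "\<Omega>' \<noteq> {}" "card \<Omega> \<le> 2 ^ d * card \<Omega>'"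
    and f: "\<And>x \<omega> m W. x \<in> strings n \<Longrightarrow> \<omega> \<in> \<Omega> \<Longrightarrow> n \<le> m \<Longrightarrow>
       protocol (strings n) (Pow W) (2 ^ s) (\<lambda>h. f x \<omega> (plant A n m h))"
    and f': "\<And>x \<omega> A. \<omega> \<in> \<Omega>' \<Longrightarrow> f x \<omega> A \<noteq> None"
  defines "m \<equiv> (a + 4) * n"
  shows "\<exists>A' w. (\<forall>b. length b \<noteq> m \<longrightarrow> A' b = A b) \<and> length w = m - n \<and>
     (\<forall>x\<in>strings n. \<forall>b. 2 ^ 2 ^ (2 * n) * card {\<omega> \<in> \<Omega>. f x \<omega> A' = Some (\<not> b)}
         \<le> card {\<omega> \<in> \<Omega>. f x \<omega> A' \<noteq> None} \<longrightarrow> A' (x @ w) = b)"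
proof -
  let ?X = "strings n" and ?W = "strings (m - n)"
  have nm: "n \<le> m" "m - n = (a + 3) * n" unfolding m_def by (simp_all add: algebra_simps)
  have n1: "1 \<le> n" using n by simp
  let ?J = "1 + card ?X * (s + d)"
  have J1: "?J + 1 \<le> 2 ^ ((a + 1) * n)"
  proof -
    have "N * (s + d) + 2 \<le> N * (s + d + 2)" if "1 \<le> N" for N using that by (simp add: algebra_simps)
    from this[of "2 ^ n"] have "?J + 1 \<le> 2 ^ n * (s + d + 2)" by (simp add: card_strings)
    also have "\<dots> \<le> 2 ^ n * 2 ^ (a * n)" using sd by (rule mult_left_mono) simp
    finally show ?thesis by (simp add: power_add)
  qed
  \<comment> \<open>There are \<open>2 ^ ((a + 3) * n)\<close> rows, while the biased ones number at
    most \<open>2 ^ ((a + 2) * n)\<close>.\<close>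
  have rows: "card ?X * (?J + 1) < card ?W"
  proof -
    have "card ?X * (?J + 1) \<le> 2 ^ n * 2 ^ ((a + 1) * n)"
      unfolding card_strings[of n, symmetric] using J1 by (rule mult_left_mono) simp
    also have "\<dots> < 2 ^ n * 2 ^ ((a + 2) * n)" using n1 by (simp add: power_strict_increasing)
    also have "\<dots> = card ?W" unfolding card_strings nm(2) by (simp add: algebra_simps flip: power_add)
    finally show ?thesis .
  qed
  \<comment> \<open>The exponent on the left is at most (a+6) n 2^n, and
    \<open>a + 6 \<le> n\<close> together with n^2 < 2^n brings it below 2^(2n).\<close>
  have E: "4 * card ?X * (2 * ?J + 4) ^ card ?X < 2 ^ 2 ^ (2 * n)"
  proof -
    have "2 * ?J + 4 \<le> 2 ^ 2 * 2 ^ ((a + 1) * n)" using J1 by simp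
    also have "\<dots> \<le> 2 ^ (2 * n) * 2 ^ ((a + 1) * n)"
      using n1 by (intro mult_right_mono power_increasing) auto
    finally have "2 * ?J + 4 \<le> 2 ^ ((a + 3) * n)" by (simp add: algebra_simps flip: power_add)
    then have "(2 * ?J + 4) ^ card ?X \<le> (2 ^ ((a + 3) * n)) ^ card ?X" by (rule power_mono) simp
    then have "4 * card ?X * (2 * ?J + 4) ^ card ?X \<le> 4 * card ?X * (2 ^ ((a + 3) * n)) ^ card ?X"
      by (rule mult_left_mono) simp
    also have "\<dots> = 2 ^ (2 + n + (a + 3) * n * 2 ^ n)"
      by (simp add: card_strings power_add power_mult)
    also have "\<dots> < 2 ^ 2 ^ (2 * n)"
    proof (rule power_strict_increasing)
      have "2 + n \<le> 3 * n * 2 ^ n"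
      proof -
        have "2 + n \<le> 3 * n * 1" using n by simp
        also have "\<dots> \<le> 3 * n * 2 ^ n" by (rule mult_left_mono) simp_all
        finally show ?thesis .
      qed
      then have "2 + n + (a + 3) * n * 2 ^ n \<le> (a + 6) * n * 2 ^ n" by (simp add: algebra_simps)
      also have "\<dots> \<le> n * n * 2 ^ n" using n by (intro mult_right_mono) auto
      also have "\<dots> < 2 ^ n * 2 ^ n"
        using square_less_power2[of n] n by (intro mult_strict_right_mono) auto
      also have "\<dots> = 2 ^ (2 * n)" by (simp add: mult_2 power_add)
      finally show "2 + n + (a + 3) * n * 2 ^ n < 2 ^ (2 * n)" .
    qed simp
    finally show ?thesis .
  qed
  have "\<exists>h \<in> PiE ?X (\<lambda>_. Pow ?W). \<exists>w\<in>?W. \<forall>x\<in>?X. \<forall>b.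
     2 ^ 2 ^ (2 * n) * card {\<omega> \<in> \<Omega>. f x \<omega> (plant A n m h) = Some (\<not> b)}
       \<le> card {\<omega> \<in> \<Omega>. f x \<omega> (plant A n m h) \<noteq> None} \<longrightarrow> (w \<in> h x) = b"
  proof (rule planting[OF finite_strings _ finite_strings \<Omega>])
    show "?X \<noteq> {}" by (metis (mono_tags, lifting) Ex_list_of_length empty_Collect_eq)
  qed (use f f' nm(1) rows E in auto)
  then obtain h w where hw: "w \<in> ?W" "\<forall>x\<in>?X. \<forall>b.
     2 ^ 2 ^ (2 * n) * card {\<omega> \<in> \<Omega>. f x \<omega> (plant A n m h) = Some (\<not> b)}
       \<le> card {\<omega> \<in> \<Omega>. f x \<omega> (plant A n m h) \<noteq> None} \<longrightarrow> (w \<in> h x) = b"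
    by (elim bexE)
  have "plant A n m h (x @ w) \<longleftrightarrow> w \<in> h x" if "x \<in> ?X" for x
    using that hw(1) nm(1) by (simp add: plant_def)
  then show ?thesis using hw
    by (intro exI[of _ "plant A n m h"] exI[of _ w]) (auto simp: plant_def)
qed

text \<open>Acceptance with a clock. During the construction a machine meets oracles for which it
  need not halt in time; the clock makes its behaviour depend on short strings of the oracle
  only.\<close>

definition yields :: "bool_oracle \<Rightarrow> machine \<Rightarrow> nat \<Rightarrow> bool list list \<Rightarrow> bool" where
  "yields A M t inputs \<longleftrightarrow> exec A M t (start M inputs) = Some True"

text \<open>A run starts with an empty query tape, so \<open>2 * t\<close> serves as the bound
  \<open>T\<close> of \<open>protocol_exec\<close>; \<open>protocol_restrict\<close> combines at
  most \<open>K\<close> runs.\<close>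

lemma protocol_yields:
  assumes "finite I" "card I \<le> K" "n \<le> m"
  shows "protocol (strings n) (Pow W) (2 ^ (K * (t * (2 ^ n * (2 * t)))))
     (\<lambda>h. \<lambda>i\<in>I. yields (plant A n m h) (M i) t (inputs i))"
proof -
  let ?k = "2 ^ (t * (2 ^ n * (2 * t))) :: nat"
  have "protocol (strings n) (Pow W) ?k (\<lambda>h. yields (plant A n m h) (M i) t (inputs i))" for i
  proof -
    obtain ts where start: "start (M i) (inputs i) = (0, ts)" by (simp add: start_def)
    have "query_tape_size ts + 2 * t \<le> 2 * t"
      using query_tape_size_start[of "M i" "inputs i"] start by simp
    then have "protocol (strings n) (Pow W) ?k (\<lambda>h. exec (plant A n m h) (M i) t (0, ts))"
      by (rule protocol_exec[OF assms(3)])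
    then show ?thesis by (rule protocol_comp) (simp add: determines_def yields_def start)
  qed
  then have "protocol (strings n) (Pow W) (?k ^ card I)
     (\<lambda>h. \<lambda>i\<in>I. yields (plant A n m h) (M i) t (inputs i))"
    by (intro protocol_restrict assms(1))
  moreover have "?k ^ card I \<le> ?k ^ K" using assms(2) by (intro power_increasing) auto
  ultimately have "protocol (strings n) (Pow W) (?k ^ K)
     (\<lambda>h. \<lambda>i\<in>I. yields (plant A n m h) (M i) t (inputs i))" by (rule protocol_mono)
  moreover have "?k ^ K = 2 ^ (K * (t * (2 ^ n * (2 * t))))" by (simp add: mult.commute flip: power_mult)
  ultimately show ?thesis by simp
qed

lemma yields_cong:
  assumes "\<And>b. length b \<le> 2 * t \<Longrightarrow> A b = A' b"
  shows "yields A M t inputs = yields A' M t inputs"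
proof -
  obtain ts where start: "start M inputs = (0, ts)" by (simp add: start_def)
  have "exec A M t (0, ts) = exec A' M t (0, ts)"
    using query_tape_size_start[of M inputs] start assms by (intro exec_cong) simp
  then show ?thesis by (simp add: yields_def start)
qed

section \<open>Postselected machines\<close>

definition post_count :: "machine \<Rightarrow> machine \<Rightarrow> nat \<Rightarrow> nat \<Rightarrow> bool list \<Rightarrow> bool_oracle \<Rightarrow> bool \<Rightarrow> nat" where
  "post_count D B t l x A b =
     card {r \<in> strings l. yields A B t [x, r] \<and> yields A D t [x, r] = b}"

text \<open>The conditional probability thresholds 2/3 and 1/3 as a factor of two between counts.
  For an arbitrary oracle it may hold for neither \<open>b\<close>, and then nothing is demanded of
  the planted row.\<close>

definition post_decides :: "machine \<times> machine \<times> nat \<times> nat \<Rightarrow> nat \<Rightarrow> bool list \<Rightarrow> bool \<Rightarrow> bool_oracle \<Rightarrow> bool" where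
  "post_decides = (\<lambda>(D, B, c, d) n x b A.
     let N = post_count D B (exp_bound c n) (exp_bound d n) x A
     in 0 < N b \<and> 2 * N (\<not> b) \<le> N b)"

text \<open>Repetition drives the error ratio required by \<open>plant_correct\<close> below the
  threshold, and one always accepted dummy seed provides density. The dummy answers no, but every
  genuine seed comes in \<open>2 ^ K\<close> tagged copies and outweighs it.\<close>

lemma post_planted:
  "\<exists>C\<ge>1. \<exists>n0. \<forall>n\<ge>n0. \<forall>A. \<exists>A' w. (\<forall>b. length b \<noteq> C * n \<longrightarrow> A' b = A b) \<and> length w = C * n - n \<and>
     (\<forall>x\<in>strings n. \<forall>b. post_decides p n x b A' \<longrightarrow> A' (x @ w) = b)"
proof -
  obtain D B c d where p: "p = (D, B, c, d)" by (cases p)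
  \<comment> \<open>\<open>(6 + 4 * c) * n\<close> bounds the exponent of \<open>?s\<close> and
    \<open>(2 * d + 5) * n\<close> that of \<open>?d + 2\<close>; their sum costs one further
    \<open>n\<close>.\<close>
  define a where "a = 7 + 4 * c + 2 * d"
  have "\<exists>A' w. (\<forall>b. length b \<noteq> (a + 4) * n \<longrightarrow> A' b = A b) \<and> length w = (a + 4) * n - n \<and>
     (\<forall>x\<in>strings n. \<forall>b. post_decides p n x b A' \<longrightarrow> A' (x @ w) = b)" if n: "a + 6 \<le> n" for n A
  proof -
    define T where "T = exp_bound c n"
    define L where "L = exp_bound d n"
    \<comment> \<open>The additional repetition gives a factor 2 that pays for the dummy
      seed.\<close>
    define K where "K = 2 ^ (2 * n) + (1 :: nat)"
    define Rs where "Rs P = {rs. set rs \<subseteq> {r \<in> strings L. P r} \<and> length rs = K}" for P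
    define \<Omega> where "\<Omega> = insert None (Some ` (Rs (\<lambda>_. True) \<times> strings K))"
    \<comment> \<open>A run is accepted if \<open>K\<close> repetitions of \<open>D\<close> agree, so the odds of an error are the \<open>K\<close>-th
      power of those of \<open>D\<close>; the tag in \<open>strings K\<close> makes the dummy seed \<open>None\<close> light.\<close>
    define f :: "bool list \<Rightarrow> (bool list list \<times> bool list) option \<Rightarrow> bool_oracle \<Rightarrow> bool option"
      where "f x \<omega> A = (case \<omega> of None \<Rightarrow> Some False
       | Some (rs, _) \<Rightarrow> if \<forall>r\<in>set rs. yields A B T [x, r] \<and> yields A D T [x, r] then Some True
           else if \<forall>r\<in>set rs. yields A B T [x, r] \<and> \<not> yields A D T [x, r] then Some False
           else None)" for x \<omega> A
    have n1: "1 \<le> n" using n by simp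
    have TL: "T \<le> 2 ^ (2 * c * n)" "L \<le> 2 ^ (2 * d * n)"
      using n1 unfolding T_def L_def by (simp_all add: exp_bound_le)
    have K: "K \<le> 2 ^ (3 * n)"
      using add_power2_bound[of "2 ^ (2 * n)" 2 n 1 0 2] n1 unfolding K_def by simp
    have finRs: "finite (Rs P)" and cRs: "card (Rs P) = card {r \<in> strings L. P r} ^ K" for P
      using finite_strings[of L] unfolding Rs_def by (simp_all add: finite_lists_length_eq card_lists_length_eq)
    have fin\<Omega>: "finite \<Omega>" unfolding \<Omega>_def using finRs finite_strings by simp
    \<comment> \<open>A seed causes \<open>K\<close> runs of each of \<open>D\<close> and
      \<open>B\<close>. There are \<open>2 ^ (L * K + K)\<close> genuine seeds and one dummy, hence
      the \<open>+ 1\<close> in \<open>?d\<close>.\<close>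
    let ?s = "(2 * K) * (T * (2 ^ n * (2 * T)))" and ?d = "L * K + K + 1"
    have "\<exists>A' w. (\<forall>b. length b \<noteq> (a + 4) * n \<longrightarrow> A' b = A b) \<and> length w = (a + 4) * n - n \<and>
     (\<forall>x\<in>strings n. \<forall>b. 2 ^ 2 ^ (2 * n) * card {\<omega> \<in> \<Omega>. f x \<omega> A' = Some (\<not> b)}
         \<le> card {\<omega> \<in> \<Omega>. f x \<omega> A' \<noteq> None} \<longrightarrow> A' (x @ w) = b)"
    proof (rule plant_correct[OF n _ fin\<Omega>, of ?s ?d "{None}"])
      have two: "2 \<le> (2 :: nat) ^ (1 * n)" "2 ^ n \<le> (2 :: nat) ^ (1 * n)"
        using n1 power_increasing[of 1 n "2 :: nat"] by simp_all
      have "?s \<le> 2 ^ ((1 + 3 + (2 * c + (1 + (1 + 2 * c)))) * n)"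
        by (intro mult_power2_bound two K TL)
      moreover have "L * K + K + 1 + 2 \<le> 2 ^ ((2 * d + 3 + 1 + 1) * n)"
      proof -
        have "L * K + K \<le> 2 ^ ((2 * d + 3 + 1) * n)"
          using mult_power2_bound[OF TL(2) K] K n1 by (intro add_power2_bound[of _ "2 * d + 3" _ _ 3]) auto
        moreover have "3 \<le> (2 :: nat) ^ (2 * n)"
          using n1 power_increasing[of 2 "2 * n" "2 :: nat"] by simp
        ultimately show ?thesis
          using n1 add_power2_bound[of "L * K + K" "2 * d + 3 + 1" n 3 2 "2 * d + 3 + 1"] by (simp add: add.assoc)
      qed
      ultimately have "?s + (L * K + K + 1 + 2) \<le> 2 ^ ((6 + 4 * c + 2 * d + 1) * n)"
        using n1 by (intro add_power2_bound) auto
      then show "?s + ?d + 2 \<le> 2 ^ (a * n)" unfolding a_def by (simp add: algebra_simps)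
      show "{None} \<subseteq> \<Omega>" "{None} \<noteq> ({} :: (bool list list \<times> bool list) option set)" unfolding \<Omega>_def by auto
      have "card \<Omega> \<le> Suc (card (Rs (\<lambda>_. True) \<times> strings K))"
        unfolding \<Omega>_def using finRs finite_strings by (simp add: card_insert_if card_image)
      also have "\<dots> = 1 + 2 ^ (L * K + K)"
        using cRs[of "\<lambda>_. True"] by (simp add: card_cartesian_product card_strings power_add power_mult)
      also have "\<dots> \<le> 2 ^ ?d" by simp
      finally show "card \<Omega> \<le> 2 ^ ?d * card {None :: (bool list list \<times> bool list) option}" by simp
      show "f x \<omega> A \<noteq> None" if "\<omega> \<in> {None}" for x \<omega> A using that by (simp add: f_def)
      fix x \<omega> m and W :: "bool list set"
      assume \<omega>: "\<omega> \<in> \<Omega>" and m: "n \<le> m"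
      show "protocol (strings n) (Pow W) (2 ^ ?s) (\<lambda>h. f x \<omega> (plant A n m h))"
      proof (cases \<omega>)
        case None
        then show ?thesis by (simp add: f_def protocol_const)
      next
        case (Some y)
        then obtain rs v where y: "\<omega> = Some (rs, v)" "length rs = K"
          using \<omega> by (auto simp: \<Omega>_def Rs_def)
        let ?I = "set rs \<times> {D, B}"
        have "card ?I \<le> card (set rs) * 2"
          unfolding card_cartesian_product by (intro mult_left_mono) (auto simp: card_insert_if)
        also have "\<dots> \<le> 2 * K" using card_length[of rs] y(2) by simp
        finally have "protocol (strings n) (Pow W) (2 ^ ?s)
            (\<lambda>h. \<lambda>i\<in>?I. yields (plant A n m h) (snd i) T [x, fst i])"
          using m by (intro protocol_yields) auto
        then show ?thesis
        proof (rule protocol_comp)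
          show "determines (strings n) (Pow W) (\<lambda>h. \<lambda>i\<in>?I. yields (plant A n m h) (snd i) T [x, fst i])
              (\<lambda>h. f x \<omega> (plant A n m h))"
            unfolding determines_def
          proof (intro ballI impI)
            fix h h' assume eq: "(\<lambda>i\<in>?I. yields (plant A n m h) (snd i) T [x, fst i])
               = (\<lambda>i\<in>?I. yields (plant A n m h') (snd i) T [x, fst i])"
            have "yields (plant A n m h) M T [x, r] = yields (plant A n m h') M T [x, r]"
              if "r \<in> set rs" "M \<in> {D, B}" for r M
              using fun_cong[OF eq, of "(r, M)"] that by simp
            then show "f x \<omega> (plant A n m h) = f x \<omega> (plant A n m h')" by (simp add: f_def y(1))
          qed
        qed
      qed
    qed
    then obtain A' w where A': "\<forall>b. length b \<noteq> (a + 4) * n \<longrightarrow> A' b = A b" "length w = (a + 4) * n - n"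
      "\<And>x b. x \<in> strings n \<Longrightarrow> 2 ^ 2 ^ (2 * n) * card {\<omega> \<in> \<Omega>. f x \<omega> A' = Some (\<not> b)}
         \<le> card {\<omega> \<in> \<Omega>. f x \<omega> A' \<noteq> None} \<Longrightarrow> A' (x @ w) = b"
      by blast
    have "A' (x @ w) = b" if x: "x \<in> strings n" and good: "post_decides p n x b A'" for x b
    proof (rule A'(3)[OF x])
      define N where "N = post_count D B T L x A'"
      have N: "0 < N b" "2 * N (\<not> b) \<le> N b"
        using good unfolding post_decides_def p N_def T_def L_def by (simp_all add: Let_def)
      define Q where "Q b = {\<omega> \<in> \<Omega>. f x \<omega> A' = Some b}" for b
      let ?R = "\<lambda>b. Rs (\<lambda>r. yields A' B T [x, r] \<and> yields A' D T [x, r] = b)"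
      have mem: "Some (rs, v) \<in> \<Omega> \<longleftrightarrow> rs \<in> Rs (\<lambda>_. True) \<and> v \<in> strings K" for rs v
        unfolding \<Omega>_def by (simp add: image_iff)
      have fT: "f x (Some (rs, v)) A' = Some True \<longleftrightarrow>
          (\<forall>r\<in>set rs. yields A' B T [x, r] \<and> yields A' D T [x, r] = True)" for rs v
        by (simp add: f_def)
      \<comment> \<open>On an empty list both tests in \<open>f\<close> would succeed and the answer
        would be True; \<open>K\<close> is positive, so \<open>rs\<close> is not empty.\<close>
      have fF: "f x (Some (rs, v)) A' = Some False \<longleftrightarrow>
          (\<forall>r\<in>set rs. yields A' B T [x, r] \<and> yields A' D T [x, r] = False)" if "length rs = K" for rs v
      proof -
        have "hd rs \<in> set rs" using that by (intro hd_in_set) (auto simp: K_def)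
        then show ?thesis by (auto simp: f_def)
      qed
      have QT: "Q True = Some ` (?R True \<times> strings K)"
      proof (rule Set.set_eqI)
        fix \<omega>
        show "\<omega> \<in> Q True \<longleftrightarrow> \<omega> \<in> Some ` (?R True \<times> strings K)"
        proof (cases \<omega>)
          case None
          then show ?thesis by (simp add: Q_def f_def image_iff)
        next
          case (Some y)
          then obtain rs v where "\<omega> = Some (rs, v)" by (cases y) simp
          then show ?thesis by (auto simp: Q_def mem fT Rs_def image_iff)
        qed
      qed
      have QF: "Q False = insert None (Some ` (?R False \<times> strings K))"
      proof (rule Set.set_eqI)
        fix \<omega>
        show "\<omega> \<in> Q False \<longleftrightarrow> \<omega> \<in> insert None (Some ` (?R False \<times> strings K))"
        proof (cases \<omega>)
          case None
          then show ?thesis by (simp add: Q_def f_def \<Omega>_def)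
        next
          case (Some y)
          then obtain rs v where "\<omega> = Some (rs, v)" by (cases y) simp
          then show ?thesis by (auto simp: Q_def mem fF Rs_def image_iff)
        qed
      qed
      have cR: "card (Some ` (?R b \<times> strings K)) = N b ^ K * 2 ^ K" for b
        unfolding N_def post_count_def
        by (simp add: card_image card_cartesian_product cRs card_strings)
      have cT: "card (Q True) = N True ^ K * 2 ^ K" unfolding QT cR ..
      have cF: "card (Q False) = Suc (N False ^ K * 2 ^ K)"
        unfolding QF using finRs finite_strings cR[of False] by (simp add: image_iff)
      \<comment> \<open>The tag factor \<open>2 ^ K\<close> on the wrong side is swallowed by the
        gap of two between the counts; the \<open>Suc\<close> is the dummy seed, present if the
        wrong answer is False.\<close>
      have "card (Q (\<not> b)) \<le> 2 * N b ^ K"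
      proof -
        have "card (Q (\<not> b)) \<le> Suc (N (\<not> b) ^ K * 2 ^ K)" by (cases b) (simp_all add: cT cF)
        also have "\<dots> = Suc ((2 * N (\<not> b)) ^ K)" by (simp add: power_mult_distrib mult.commute)
        also have "\<dots> \<le> Suc (N b ^ K)" using power_mono[OF N(2), of K] by simp
        also have "\<dots> \<le> 2 * N b ^ K" using N(1) by (simp add: Suc_le_eq)
        finally show ?thesis .
      qed
      then have "2 ^ 2 ^ (2 * n) * card (Q (\<not> b)) \<le> 2 ^ 2 ^ (2 * n) * (2 * N b ^ K)"
        by (rule mult_left_mono) simp
      also have "\<dots> = N b ^ K * 2 ^ K" by (simp add: K_def)
      also have "\<dots> \<le> card (Q b)" by (cases b) (simp_all add: cT cF)
      also have "\<dots> \<le> card {\<omega> \<in> \<Omega>. f x \<omega> A' \<noteq> None}"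
        using fin\<Omega> by (intro card_mono) (auto simp: Q_def)
      finally show "2 ^ 2 ^ (2 * n) * card {\<omega> \<in> \<Omega>. f x \<omega> A' = Some (\<not> b)}
         \<le> card {\<omega> \<in> \<Omega>. f x \<omega> A' \<noteq> None}" unfolding Q_def .
    qed
    then show ?thesis using A'(1,2) by (intro exI[of _ A'] exI[of _ w] conjI ballI allI impI) simp_all
  qed
  then have "\<forall>n\<ge>a + 6. \<forall>A. \<exists>A' w. (\<forall>b. length b \<noteq> (a + 4) * n \<longrightarrow> A' b = A b) \<and>
     length w = (a + 4) * n - n \<and> (\<forall>x\<in>strings n. \<forall>b. post_decides p n x b A' \<longrightarrow> A' (x @ w) = b)"
    by (intro allI impI)
  moreover have "1 \<le> a + 4" by simp
  ultimately show ?thesis by (intro exI[of _ "a + 4"] exI[of _ "a + 6"] conjI)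
qed

section \<open>Verifiers with a proof\<close>

definition ma_count :: "machine \<Rightarrow> nat \<Rightarrow> nat \<Rightarrow> bool list \<Rightarrow> bool_oracle \<Rightarrow> bool list \<Rightarrow> nat" where
  "ma_count V t l x A \<pi> = card {r \<in> strings l. yields A V t [x, \<pi>, r]}"

text \<open>The acceptance thresholds with denominators cleared; as for \<open>post_decides\<close>,
  neither answer need be decided for an arbitrary oracle.\<close>

definition ma_decides :: "machine \<times> nat \<times> nat \<times> nat \<Rightarrow> nat \<Rightarrow> bool list \<Rightarrow> bool \<Rightarrow> bool_oracle \<Rightarrow> bool" where
  "ma_decides = (\<lambda>(V, c, d, e) n x b A.
     let N = ma_count V (exp_bound c n) (exp_bound d n) x A
     in if b then \<exists>\<pi>. length \<pi> \<le> exp_bound e n \<and> 2 * 2 ^ exp_bound d n \<le> 3 * N \<pi>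
        else \<forall>\<pi>. length \<pi> \<le> exp_bound e n \<longrightarrow> 3 * N \<pi> \<le> 2 ^ exp_bound d n)"

lemma strings_upto:
  "finite {\<pi> :: bool list. length \<pi> \<le> l}" "card {\<pi> :: bool list. length \<pi> \<le> l} \<le> 2 ^ (l + 1)"
proof -
  show "finite {\<pi> :: bool list. length \<pi> \<le> l}"
    using finite_lists_length_le[of "UNIV :: bool set" l] by simp
  have "card {\<pi> :: bool list. length \<pi> \<le> l} = (\<Sum>i\<le>l. 2 ^ i)"
    using card_lists_length_le[of "UNIV :: bool set" l] by simp
  also have "\<dots> \<le> 2 ^ (l + 1)"
    by (induction l) auto
  finally show "card {\<pi> :: bool list. length \<pi> \<le> l} \<le> 2 ^ (l + 1)" .
qed

text \<open>A seed contains a proof together with \<open>K\<close> coin sequences. For the answer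
  True a single good proof has to outweigh the dummy seeds, while for False the dummies have to
  outweigh all proofs together, so \<open>K\<close> must also beat the number of proofs.\<close>

lemma ma_planted:
  "\<exists>C\<ge>1. \<exists>n0. \<forall>n\<ge>n0. \<forall>A. \<exists>A' w. (\<forall>b. length b \<noteq> C * n \<longrightarrow> A' b = A b) \<and> length w = C * n - n \<and>
     (\<forall>x\<in>strings n. \<forall>b. ma_decides p n x b A' \<longrightarrow> A' (x @ w) = b)"
proof -
  obtain V c d e where p: "p = (V, c, d, e)" by (cases p)
  define a where "a = 4 * c + 2 * e + 11"
  have "\<exists>A' w. (\<forall>b. length b \<noteq> (a + 4) * n \<longrightarrow> A' b = A b) \<and> length w = (a + 4) * n - n \<and>
     (\<forall>x\<in>strings n. \<forall>b. ma_decides p n x b A' \<longrightarrow> A' (x @ w) = b)" if n: "a + 6 \<le> n" for n A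
  proof -
    define T where "T = exp_bound c n"
    \<comment> \<open>The coin length is \<open>Suc l\<close>, so \<open>2 ^ l\<close> is half the
      number of coin sequences and \<open>2 ^ (l * K)\<close> the number of dummy seeds.\<close>
    define l where "l = exp_bound d n - 1"
    define pl where "pl = exp_bound e n"
    \<comment> \<open>Relative to \<open>2 ^ l\<close>, a good proof has at least 4/3 and a false
      one at most 2/3 accepting coin sequences. Sixth powers of these ratios are above 2 and below
      1/8, so \<open>6 * q\<close> repetitions give factors \<open>2 ^ q\<close> and
      \<open>8 ^ q\<close>. The summand \<open>pl\<close> pays for the number of proofs.\<close>
    define q where "q = 2 ^ (2 * n) + pl"
    define K where "K = 6 * q"
    define Rs where "Rs P = {rs. set rs \<subseteq> {r \<in> strings (Suc l). P r} \<and> length rs = K}" for P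
    define Pi where "Pi = {\<pi> :: bool list. length \<pi> \<le> pl}"
    define \<Omega> where "\<Omega> = (Pi \<times> Rs (\<lambda>_. True)) <+> strings (l * K)"
    \<comment> \<open>The \<open>Inr\<close> seeds are \<open>2\<^bsup>-K\<^esup>\<close> times as many as the coin sequences, which lies between the
      fractions \<open>(1/3)\<^bsup>K\<^esup>\<close> and \<open>(2/3)\<^bsup>K\<^esup>\<close> accepted with a false and with a good proof.\<close>
    define f :: "bool list \<Rightarrow> (bool list \<times> bool list list) + bool list \<Rightarrow> bool_oracle \<Rightarrow> bool option"
      where "f x \<omega> A = (case \<omega> of Inr _ \<Rightarrow> Some False
       | Inl (\<pi>, rs) \<Rightarrow> if \<forall>r\<in>set rs. yields A V T [x, \<pi>, r] then Some True else None)" for x \<omega> A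
    have n1: "1 \<le> n" using n by simp
    have l: "exp_bound d n = Suc l" unfolding l_def exp_bound_def by simp
    have T: "T \<le> 2 ^ (2 * c * n)" and pl: "pl \<le> 2 ^ (2 * e * n)"
      using n1 unfolding T_def pl_def by (simp_all add: exp_bound_le)
    have K: "K \<le> 2 ^ ((2 * e + 6) * n)"
    proof -
      have "6 \<le> (2 :: nat) ^ (3 * n)" using n1 power_increasing[of 3 "3 * n" "2 :: nat"] by simp
      moreover have "q \<le> 2 ^ ((2 * e + 2 + 1) * n)"
        unfolding q_def using pl n1 by (intro add_power2_bound[of _ 2 _ _ "2 * e"]) auto
      ultimately have "K \<le> 2 ^ ((3 + (2 * e + 2 + 1)) * n)" unfolding K_def by (rule mult_power2_bound)
      moreover have "3 + (2 * e + 2 + 1) = 2 * e + 6" by simp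
      ultimately show ?thesis by (simp only:)
    qed
    have finRs: "finite (Rs P)" and cRs: "card (Rs P) = card {r \<in> strings (Suc l). P r} ^ K" for P
      using finite_strings[of "Suc l"] unfolding Rs_def
      by (simp_all add: finite_lists_length_eq card_lists_length_eq)
    have finPi: "finite Pi" and cPi: "card Pi \<le> 2 ^ (pl + 1)"
      unfolding Pi_def by (rule strings_upto)+
    have fin\<Omega>: "finite \<Omega>" unfolding \<Omega>_def using finRs finPi finite_strings by simp
    \<comment> \<open>Relative to the dummies, the factor \<open>2 ^ K\<close> comes from the last
      coin of each run, \<open>2 ^ (pl + 1)\<close> from the proofs, and one more 2 from adding the
      dummies themselves.\<close>
    let ?s = "K * (T * (2 ^ n * (2 * T)))" and ?d = "pl + 2 + K"
    have "\<exists>A' w. (\<forall>b. length b \<noteq> (a + 4) * n \<longrightarrow> A' b = A b) \<and> length w = (a + 4) * n - n \<and>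
     (\<forall>x\<in>strings n. \<forall>b. 2 ^ 2 ^ (2 * n) * card {\<omega> \<in> \<Omega>. f x \<omega> A' = Some (\<not> b)}
         \<le> card {\<omega> \<in> \<Omega>. f x \<omega> A' \<noteq> None} \<longrightarrow> A' (x @ w) = b)"
    proof (rule plant_correct[OF n _ fin\<Omega>, of ?s ?d "Inr ` strings (l * K)"])
      have two: "2 \<le> (2 :: nat) ^ (1 * n)" "2 ^ n \<le> (2 :: nat) ^ (1 * n)"
        using n1 power_increasing[of 1 n "2 :: nat"] by simp_all
      have "?s \<le> 2 ^ (((2 * e + 6) + (2 * c + (1 + (1 + 2 * c)))) * n)"
        by (intro mult_power2_bound two K T)
      moreover have "?d + 2 \<le> 2 ^ ((2 * e + 8) * n)"
      proof -
        have "pl + K \<le> 2 ^ ((2 * e + 6 + 1) * n)"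
          using pl K n1 by (intro add_power2_bound[of _ "2 * e" _ _ "2 * e + 6"]) auto
        moreover have "4 \<le> (2 :: nat) ^ (2 * n)"
          using n1 power_increasing[of 2 "2 * n" "2 :: nat"] by simp
        ultimately have "(pl + K) + 4 \<le> 2 ^ ((2 * e + 7 + 1) * n)"
          using n1 by (intro add_power2_bound[of _ "2 * e + 7" _ _ 2]) (auto simp: add.commute)
        moreover have "(pl + K) + 4 = ?d + 2" "2 * e + 7 + 1 = 2 * e + 8" by simp_all
        ultimately show ?thesis by (simp only:)
      qed
      ultimately have "?s + (?d + 2) \<le> 2 ^ ((4 * c + 2 * e + 10 + 1) * n)"
        using n1 by (intro add_power2_bound) auto
      then show "?s + ?d + 2 \<le> 2 ^ (a * n)" unfolding a_def by (simp add: algebra_simps)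
      show "Inr ` strings (l * K) \<subseteq> \<Omega>" unfolding \<Omega>_def by auto
      have "replicate (l * K) True \<in> strings (l * K)" by simp
      then show "Inr ` strings (l * K) \<noteq> ({} :: (bool list \<times> bool list list + bool list) set)" by blast
      have "card \<Omega> = card Pi * (2 ^ Suc l) ^ K + 2 ^ (l * K)"
        unfolding \<Omega>_def using finPi finRs finite_strings cRs[of "\<lambda>_. True"]
        by (simp add: card_Plus card_cartesian_product card_strings)
      also have "\<dots> \<le> 2 ^ (pl + 1) * (2 ^ Suc l) ^ K + 2 ^ (l * K)"
        using cPi by (intro add_right_mono mult_right_mono) auto
      also have "(2 ^ Suc l) ^ K = (2 :: nat) ^ K * 2 ^ (l * K)"
        by (simp add: power_mult power_mult_distrib)
      also have "2 ^ (pl + 1) * (2 ^ K * 2 ^ (l * K)) + 2 ^ (l * K)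
          \<le> 2 ^ (pl + 1) * (2 ^ K * 2 ^ (l * K)) + 2 ^ (pl + 1) * (2 ^ K * (2 :: nat) ^ (l * K))"
        by (rule add_left_mono) simp
      also have "\<dots> = 2 ^ ?d * 2 ^ (l * K)" by (simp add: power_add)
      finally show "card \<Omega> \<le> 2 ^ ?d * card (Inr ` strings (l * K) :: (bool list \<times> bool list list + bool list) set)"
        by (simp add: card_image card_strings)
      show "f x \<omega> A \<noteq> None" if "\<omega> \<in> Inr ` strings (l * K)" for x \<omega> A using that by (auto simp: f_def)
      fix x \<omega> m and W :: "bool list set"
      assume \<omega>: "\<omega> \<in> \<Omega>" and m: "n \<le> m"
      show "protocol (strings n) (Pow W) (2 ^ ?s) (\<lambda>h. f x \<omega> (plant A n m h))"
      proof (cases \<omega>)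
        case (Inr v)
        then show ?thesis by (simp add: f_def protocol_const)
      next
        case (Inl y)
        then obtain \<pi> rs where y: "\<omega> = Inl (\<pi>, rs)" "length rs = K"
          using \<omega> by (auto simp: \<Omega>_def Rs_def)
        have "card (set rs) \<le> K" using card_length[of rs] y(2) by simp
        then have "protocol (strings n) (Pow W) (2 ^ ?s)
            (\<lambda>h. \<lambda>r\<in>set rs. yields (plant A n m h) V T [x, \<pi>, r])"
          using m by (intro protocol_yields) auto
        then show ?thesis
        proof (rule protocol_comp)
          show "determines (strings n) (Pow W) (\<lambda>h. \<lambda>r\<in>set rs. yields (plant A n m h) V T [x, \<pi>, r])
              (\<lambda>h. f x \<omega> (plant A n m h))"
            unfolding determines_def
          proof (intro ballI impI)
            fix h h' assume eq: "(\<lambda>r\<in>set rs. yields (plant A n m h) V T [x, \<pi>, r])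
               = (\<lambda>r\<in>set rs. yields (plant A n m h') V T [x, \<pi>, r])"
            have "yields (plant A n m h) V T [x, \<pi>, r] = yields (plant A n m h') V T [x, \<pi>, r]"
              if "r \<in> set rs" for r
              using fun_cong[OF eq, of r] that by simp
            then show "f x \<omega> (plant A n m h) = f x \<omega> (plant A n m h')" by (simp add: f_def y(1))
          qed
        qed
      qed
    qed
    then obtain A' w where A': "\<forall>b. length b \<noteq> (a + 4) * n \<longrightarrow> A' b = A b" "length w = (a + 4) * n - n"
      "\<And>x b. x \<in> strings n \<Longrightarrow> 2 ^ 2 ^ (2 * n) * card {\<omega> \<in> \<Omega>. f x \<omega> A' = Some (\<not> b)}
         \<le> card {\<omega> \<in> \<Omega>. f x \<omega> A' \<noteq> None} \<Longrightarrow> A' (x @ w) = b"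
      by blast
    have "A' (x @ w) = b" if x: "x \<in> strings n" and good: "ma_decides p n x b A'" for x b
    proof (rule A'(3)[OF x])
      define N where "N = ma_count V T (Suc l) x A'"
      define Q where "Q b = {\<omega> \<in> \<Omega>. f x \<omega> A' = Some b}" for b
      let ?v = "2 ^ l :: nat"
      let ?R = "\<lambda>\<pi>. Rs (\<lambda>r. yields A' V T [x, \<pi>, r])"
      have QF: "Q False = Inr ` strings (l * K)"
      proof (rule Set.set_eqI)
        fix \<omega>
        show "\<omega> \<in> Q False \<longleftrightarrow> \<omega> \<in> Inr ` strings (l * K)"
        proof (cases \<omega>)
          case (Inl y)
          then show ?thesis by (cases y) (auto simp: Q_def f_def)
        next
          case (Inr v)
          then show ?thesis by (auto simp: Q_def f_def \<Omega>_def)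
        qed
      qed
      have QT: "Q True = Inl ` Sigma Pi ?R"
      proof (rule Set.set_eqI)
        fix \<omega>
        show "\<omega> \<in> Q True \<longleftrightarrow> \<omega> \<in> Inl ` Sigma Pi ?R"
        proof (cases \<omega>)
          case (Inl y)
          then obtain \<pi> rs where "\<omega> = Inl (\<pi>, rs)" by (cases y) simp
          then show ?thesis by (auto simp: Q_def \<Omega>_def f_def Rs_def image_iff)
        next
          case (Inr v)
          then show ?thesis by (auto simp: Q_def f_def)
        qed
      qed
      have cF: "card (Q False) = ?v ^ K"
        unfolding QF by (simp add: card_image card_strings power_mult)
      have "card (Q True) = card (Sigma Pi ?R)" unfolding QT by (rule card_image) simp
      also have "\<dots> = (\<Sum>\<pi>\<in>Pi. N \<pi> ^ K)"
        using finPi finRs by (simp add: card_SigmaI cRs N_def ma_count_def)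
      finally have cT: "card (Q True) = (\<Sum>\<pi>\<in>Pi. N \<pi> ^ K)" .
      have pK: "y ^ K = (y ^ 6) ^ q" for y :: nat by (simp add: K_def power_mult)
      have "2 ^ 2 ^ (2 * n) * card (Q (\<not> b)) \<le> card (Q b)"
      proof (cases b)
        case True
        then obtain \<pi> where \<pi>: "\<pi> \<in> Pi" "2 * 2 ^ Suc l \<le> 3 * N \<pi>"
          using good unfolding ma_decides_def p Let_def Pi_def N_def T_def l[symmetric] pl_def by auto
        have "(4 * ?v) ^ 6 \<le> (3 * N \<pi>) ^ 6" using \<pi>(2) by (intro power_mono) simp_all
        then have "2 * ?v ^ 6 \<le> N \<pi> ^ 6" by (simp add: power_mult_distrib)
        then have "(2 * ?v ^ 6) ^ q \<le> (N \<pi> ^ 6) ^ q" by (rule power_mono) simp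
        then have "2 ^ q * ?v ^ K \<le> N \<pi> ^ K" by (simp only: pK power_mult_distrib)
        also have "\<dots> \<le> card (Q True)" unfolding cT using \<pi>(1) finPi by (intro member_le_sum) auto
        finally have le: "2 ^ q * card (Q False) \<le> card (Q True)" by (simp only: cF)
        have "2 ^ 2 ^ (2 * n) * card (Q False) \<le> 2 ^ q * card (Q False)"
          by (intro mult_right_mono power_increasing) (auto simp: q_def)
        then have "2 ^ 2 ^ (2 * n) * card (Q False) \<le> card (Q True)" using le by (rule order.trans)
        then show ?thesis using True by simp
      next
        case False
        have le: "8 ^ q * N \<pi> ^ K \<le> ?v ^ K" if "\<pi> \<in> Pi" for \<pi>
        proof -
          have "3 * N \<pi> \<le> 2 ^ Suc l"
            using good that False unfolding ma_decides_def p Let_def Pi_def N_def T_def l[symmetric] pl_def by auto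
          then have "(3 * N \<pi>) ^ 6 \<le> (2 * ?v) ^ 6" by (intro power_mono) simp_all
          then have "8 * N \<pi> ^ 6 \<le> ?v ^ 6" by (simp add: power_mult_distrib)
          then have "(8 * N \<pi> ^ 6) ^ q \<le> (?v ^ 6) ^ q" by (rule power_mono) simp
          then show ?thesis by (simp only: pK power_mult_distrib)
        qed
        have "8 ^ q * card (Q True) = (\<Sum>\<pi>\<in>Pi. 8 ^ q * N \<pi> ^ K)" unfolding cT by (rule sum_distrib_left)
        also have "\<dots> \<le> (\<Sum>\<pi>\<in>Pi. ?v ^ K)" using le by (rule sum_mono)
        also have "\<dots> \<le> 2 ^ (pl + 1) * ?v ^ K" using cPi by (simp add: mult_right_mono)
        finally have *: "8 ^ q * card (Q True) \<le> 2 ^ (pl + 1) * card (Q False)" unfolding cF .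
        \<comment> \<open>The gain \<open>8 ^ q\<close> covers both the union over the proofs and
          the required error ratio.\<close>
        have "(2 :: nat) ^ (pl + 1) * 2 ^ 2 ^ (2 * n) \<le> 2 ^ (3 * q)"
          unfolding power_add[symmetric]
        proof (rule power_increasing)
          have "pl + 1 + N \<le> 3 * (N + pl)" if "1 \<le> N" for N using that by simp
          then show "pl + 1 + 2 ^ (2 * n) \<le> 3 * q" unfolding q_def by this simp
        qed simp
        also have "\<dots> = 8 ^ q" by (simp add: power_mult)
        finally have "2 ^ (pl + 1) * 2 ^ 2 ^ (2 * n) * card (Q True) \<le> 8 ^ q * card (Q True)"
          by (rule mult_right_mono) simp
        then have "2 ^ (pl + 1) * (2 ^ 2 ^ (2 * n) * card (Q True)) \<le> 2 ^ (pl + 1) * card (Q False)"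
          using * by (simp only: mult.assoc)
        then have "2 ^ 2 ^ (2 * n) * card (Q True) \<le> card (Q False)"
          by (subst (asm) mult_le_cancel1) auto
        then show ?thesis using False by simp
      qed
      also have "\<dots> \<le> card {\<omega> \<in> \<Omega>. f x \<omega> A' \<noteq> None}"
        using fin\<Omega> by (intro card_mono) (auto simp: Q_def)
      finally show "2 ^ 2 ^ (2 * n) * card {\<omega> \<in> \<Omega>. f x \<omega> A' = Some (\<not> b)}
         \<le> card {\<omega> \<in> \<Omega>. f x \<omega> A' \<noteq> None}" unfolding Q_def .
    qed
    then show ?thesis using A'(1,2) by (intro exI[of _ A'] exI[of _ w] conjI ballI allI impI) simp_all
  qed
  then have "\<forall>n\<ge>a + 6. \<forall>A. \<exists>A' w. (\<forall>b. length b \<noteq> (a + 4) * n \<longrightarrow> A' b = A b) \<and>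
     length w = (a + 4) * n - n \<and> (\<forall>x\<in>strings n. \<forall>b. ma_decides p n x b A' \<longrightarrow> A' (x @ w) = b)"
    by (intro allI impI)
  moreover have "1 \<le> a + 4" by simp
  ultimately show ?thesis by (intro exI[of _ "a + 4"] exI[of _ "a + 6"] conjI)
qed

section \<open>Diagonalisation\<close>

instance sym :: countable by countable_datatype
instance dir :: countable by countable_datatype
instance action :: countable by countable_datatype
instance machine :: countable by countable_datatype

text \<open>A finite extension argument. Each stage serves one requirement at a length where
  planting leaves all frozen strings alone, then freezes everything on which the success depends.
  Pairing lets each requirement recur, hence infinitely many lengths.\<close>

lemma diagonal:
  fixes good :: "'e :: countable \<Rightarrow> nat \<Rightarrow> bool list \<Rightarrow> bool \<Rightarrow> bool_oracle \<Rightarrow> bool"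
  assumes plant: "\<And>p. \<exists>C\<ge>1. \<exists>n0. \<forall>n\<ge>n0. \<forall>A. \<exists>A' w. (\<forall>b. length b \<noteq> C * n \<longrightarrow> A' b = A b) \<and>
      length w = C * n - n \<and> (\<forall>x\<in>strings n. \<forall>b. good p n x b A' \<longrightarrow> A' (x @ w) = b)"
    and local: "\<And>p n x b A A'. (\<And>y. length y \<le> \<tau> p n \<Longrightarrow> A y = A' y) \<Longrightarrow> good p n x b A = good p n x b A'"
  shows "\<exists>A. \<forall>p. \<exists>C. \<exists>\<^sub>\<infinity>n. \<exists>w. length w = C * n - n \<and>
      (\<forall>x\<in>strings n. \<forall>b. good p n x b A \<longrightarrow> A (x @ w) = b)"
proof -
  define step where "step C p n A A' \<longleftrightarrow> (\<forall>b. length b \<noteq> C * n \<longrightarrow> A' b = A b) \<and> (\<exists>w. length w = C * n - n \<and>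
      (\<forall>x\<in>strings n. \<forall>b. good p n x b A' \<longrightarrow> A' (x @ w) = b))" for C p n A A'
  have "\<exists>C\<ge>1. \<exists>n0. \<forall>n\<ge>n0. \<forall>A. \<exists>A'. step C p n A A'" for p
    using plant[of p] unfolding step_def by simp
  then obtain C where C: "\<And>p. 1 \<le> C p" "\<And>p. \<exists>n0. \<forall>n\<ge>n0. \<forall>A. \<exists>A'. step (C p) p n A A'"
    by metis
  define ok where "ok p n A \<longleftrightarrow> (\<exists>w. length w = C p * n - n \<and>
      (\<forall>x\<in>strings n. \<forall>b. good p n x b A \<longrightarrow> A (x @ w) = b))" for p n A
  \<comment> \<open>Success at \<open>n\<close> depends only on the strings seen by the machine and
    on those of length \<open>C p * n\<close>, which contain the planted row.\<close>
  have ok_local: "ok p n A'" if A: "ok p n A" and eq: "\<And>y. length y \<le> max (\<tau> p n) (C p * n) \<Longrightarrow> A y = A' y" for p n A A'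
  proof -
    obtain w where w: "length w = C p * n - n" "\<forall>x\<in>strings n. \<forall>b. good p n x b A \<longrightarrow> A (x @ w) = b"
      using A unfolding ok_def by (elim exE conjE)
    have n: "n \<le> C p * n" using mult_le_mono1[OF C(1)[of p], of n] by simp
    have "A (x @ w) = A' (x @ w)" if "x \<in> strings n" for x
    proof (rule eq)
      have "length x = n" using that by simp
      then have "length (x @ w) = n + (C p * n - n)" by (simp only: length_append w(1))
      also have "\<dots> = C p * n" using n by (rule le_add_diff_inverse)
      finally show "length (x @ w) \<le> max (\<tau> p n) (C p * n)" by simp
    qed
    moreover have "good p n x b A = good p n x b A'" for x b
      by (rule local, rule eq) simp
    ultimately have "\<forall>x\<in>strings n. \<forall>b. good p n x b A' \<longrightarrow> A' (x @ w) = b" using w(2) by auto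
    then show ?thesis using w(1) unfolding ok_def by (intro exI[of _ w] conjI)
  qed
  \<comment> \<open>A state is an oracle with the length up to which it is frozen. Stage
    \<open>i\<close> serves the requirement coded by the first component of
    \<open>i\<close>.\<close>
  define P where "P i s s' \<longleftrightarrow> (\<forall>b. length b \<le> snd s \<longrightarrow> fst s' b = fst s b) \<and> snd s < snd s' \<and>
      (\<exists>n\<ge>i. ok (from_nat (fst (prod_decode i))) n (fst s') \<and>
         max (\<tau> (from_nat (fst (prod_decode i))) n) (C (from_nat (fst (prod_decode i))) * n) \<le> snd s')"
    for i :: nat and s s' :: "bool_oracle \<times> nat"
  have "\<exists>s'. P i s s'" for i s
  proof -
    define p where "p = (from_nat (fst (prod_decode i)) :: 'e)"
    obtain n0 where n0: "\<And>n A. n0 \<le> n \<Longrightarrow> \<exists>A'. step (C p) p n A A'"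
      using C(2)[of p] by blast
    define n where "n = n0 + i + Suc (snd s)"
    have "n0 \<le> n" by (simp add: n_def)
    then obtain A' where A': "step (C p) p n (fst s) A'" using n0 by blast
    then have "ok p n A'" unfolding step_def ok_def by (rule conjunct2)
    moreover have "n \<le> C p * n" using mult_le_mono1[OF C(1)[of p], of n] by simp
    then have "\<forall>b. length b \<le> snd s \<longrightarrow> A' b = fst s b"
      using A' unfolding step_def by (auto simp: n_def)
    moreover have "i \<le> n" by (simp add: n_def)
    ultimately show ?thesis
      unfolding P_def p_def[symmetric]
      by (intro exI[of _ "(A', Suc (snd s) + max (\<tau> p n) (C p * n))"] conjI exI[of _ n])
        (simp_all only: fst_conv snd_conv le_add2 less_add_Suc1 plus_nat.add_Suc le_SucI)
  qed
  then obtain g where g: "\<And>i s. P i s (g i s)" by metis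
  define S where "S = rec_nat (\<lambda>_. False, 0) g"
  have S: "P i (S i) (S (Suc i))" for i using g by (simp add: S_def)
  have S_agree: "fst (S (Suc i)) b = fst (S i) b" if "length b \<le> snd (S i)" for i b
    using S[of i] that unfolding P_def by blast
  have S_less: "snd (S i) < snd (S (Suc i))" for i
    using S[of i] unfolding P_def by blast
  have snd_ge: "i \<le> snd (S i)" for i
  proof (induction i)
    case (Suc i)
    then show ?case using S_less[of i] by linarith
  qed simp
  have mono: "snd (S i) \<le> snd (S (i + k))" for i k
  proof (induction k)
    case (Suc k)
    then show ?case using S_less[of "i + k"] by simp
  qed simp
  have stable: "fst (S j) b = fst (S i) b" if len: "length b \<le> snd (S i)" and "i \<le> j" for b i j
  proof -
    have "fst (S (i + k)) b = fst (S i) b" for k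
    proof (induction k)
      case (Suc k)
      have "fst (S (Suc (i + k))) b = fst (S (i + k)) b"
        by (rule S_agree) (rule order.trans[OF len mono])
      then show ?case using Suc.IH by simp
    qed simp
    then show ?thesis using le_add_diff_inverse[OF \<open>i \<le> j\<close>] by metis
  qed
  \<comment> \<open>Stage \<open>i\<close> has frozen all lengths up to \<open>i\<close>, so stage
    \<open>length b\<close> already shows the final value at \<open>b\<close>.\<close>
  define A where "A b = fst (S (length b)) b" for b
  have A: "A b = fst (S i) b" if "length b \<le> snd (S i)" for b i
  proof (cases "i \<le> length b")
    case True
    then show ?thesis unfolding A_def by (rule stable[OF that])
  next
    case False
    then have "length b \<le> i" by simp
    then show ?thesis unfolding A_def by (rule stable[OF snd_ge, symmetric])
  qed
  have "\<exists>\<^sub>\<infinity>n. ok p n A" for p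
    unfolding INFM_nat_le
  proof
    fix k
    \<comment> \<open>The second component forces the stage, and with it the length
      \<open>n\<close>, to be at least \<open>k\<close>.\<close>
    define i where "i = prod_encode (to_nat p, k)"
    have p: "from_nat (fst (prod_decode i)) = p" by (simp add: i_def)
    have "k \<le> i" unfolding i_def by (rule le_prod_encode_2)
    obtain n where n: "i \<le> n" "ok p n (fst (S (Suc i)))" "max (\<tau> p n) (C p * n) \<le> snd (S (Suc i))"
      using S[of i] unfolding P_def p by blast
    have "ok p n A" using n(2)
    proof (rule ok_local)
      fix y :: "bool list" assume "length y \<le> max (\<tau> p n) (C p * n)"
      then show "fst (S (Suc i)) y = A y" using A n(3) by (metis order.trans)
    qed
    then show "\<exists>n\<ge>k. ok p n A" using n(1) \<open>k \<le> i\<close> by (intro exI[of _ n]) simp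
  qed
  then show ?thesis unfolding ok_def by (intro exI[of _ A] allI exI)
qed

section \<open>The planted row as advice of a linear size circuit\<close>

definition advice_circuit :: "nat \<Rightarrow> bool list \<Rightarrow> circuit" where
  "advice_circuit n w = Circuit (map GConst w @ [GOracle [0..<n + length w]]) (n + length w)"

lemma foldl_GConst:
  "foldl (\<lambda>v g. v @ [gate_val A v g]) x (map GConst w) = x @ w"
  by (induction w arbitrary: x) simp_all

lemma advice_circuit:
  "circuit_on n (advice_circuit n w)"
  "circuit_size (advice_circuit n w) = 2 * length w + n + 1"
  "length x = n \<Longrightarrow> circuit_val A (advice_circuit n w) x = A (x @ w)"
proof -
  show "circuit_on n (advice_circuit n w)"
    unfolding circuit_on_def
  proof (intro conjI allI impI ballI)
    fix j i assume j: "j < length (gates (advice_circuit n w))"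
      and i: "i \<in> set (gate_wires (gates (advice_circuit n w) ! j))"
    show "i < n + j"
    proof (cases "j < length w")
      case True
      then show ?thesis using i by (simp add: advice_circuit_def nth_append)
    next
      case False
      then have "j = length w" using j by (simp add: advice_circuit_def)
      then have "gate_wires (gates (advice_circuit n w) ! j) = [0..<n + j]"
        by (simp add: advice_circuit_def nth_append)
      then show ?thesis using i by (simp only: set_upt atLeastLessThan_iff)
    qed
  qed (simp add: advice_circuit_def)
  show "circuit_size (advice_circuit n w) = 2 * length w + n + 1"
    unfolding circuit_size_def advice_circuit_def by (simp add: comp_def sum_list_triv)
  assume x: "length x = n"
  have "map ((!) (x @ w)) [0..<n + length w] = x @ w"
    using x by (metis length_append map_nth)
  then show "circuit_val A (advice_circuit n w) x = A (x @ w)"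
    using x unfolding circuit_val_def advice_circuit_def by (simp add: foldl_GConst nth_append)
qed

lemma io_SIZE_linearI:
  assumes "Yes \<inter> No = {}"
    and inf: "\<exists>\<^sub>\<infinity>n. \<exists>w. length w = C * n - n \<and> (\<forall>x\<in>strings n. \<forall>b. good n x b \<longrightarrow> A (x @ w) = b)"
    and yes: "\<And>x. x \<in> Yes \<Longrightarrow> good (length x) x True"
    and no: "\<And>x. x \<in> No \<Longrightarrow> good (length x) x False"
  shows "(Yes, No) \<in> io_SIZE_linear A"
proof -
  have "\<exists>\<^sub>\<infinity>n. \<exists>C'. circuit_on n C' \<and> circuit_size C' \<le> (2 * C + 2) * n \<and>
        (\<forall>x. length x = n \<longrightarrow>
           (x \<in> Yes \<longrightarrow> circuit_val A C' x) \<and> (x \<in> No \<longrightarrow> \<not> circuit_val A C' x))"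
    unfolding INFM_nat_le
  proof
    fix k
    \<comment> \<open>A positive \<open>n\<close> lets the constant 1 in the circuit size be bounded
      by \<open>n\<close>.\<close>
    have "\<exists>n\<ge>Suc k. \<exists>w. length w = C * n - n \<and> (\<forall>x\<in>strings n. \<forall>b. good n x b \<longrightarrow> A (x @ w) = b)"
      using inf unfolding INFM_nat_le by (rule spec)
    then obtain n where "Suc k \<le> n \<and> (\<exists>w. length w = C * n - n \<and> (\<forall>x\<in>strings n. \<forall>b. good n x b \<longrightarrow> A (x @ w) = b))" ..
    then have n: "Suc k \<le> n"
      and "\<exists>w. length w = C * n - n \<and> (\<forall>x\<in>strings n. \<forall>b. good n x b \<longrightarrow> A (x @ w) = b)" by (rule conjunct1, rule conjunct2)
    from this(2) obtain w
      where "length w = C * n - n \<and> (\<forall>x\<in>strings n. \<forall>b. good n x b \<longrightarrow> A (x @ w) = b)" ..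
    then have w: "length w = C * n - n" "\<forall>x\<in>strings n. \<forall>b. good n x b \<longrightarrow> A (x @ w) = b"
      by (rule conjunct1, rule conjunct2)
    have "length w \<le> C * n" using w(1) by (simp only: diff_le_self)
    moreover have "(2 * C + 2) * n = 2 * (C * n) + 2 * n" by (simp add: algebra_simps)
    ultimately have "2 * length w + n + 1 \<le> (2 * C + 2) * n" using n by linarith
    moreover have "(x \<in> Yes \<longrightarrow> A (x @ w)) \<and> (x \<in> No \<longrightarrow> \<not> A (x @ w))" if "length x = n" for x
      using w(2) yes[of x] no[of x] that by auto
    ultimately show "\<exists>n\<ge>k. \<exists>C'. circuit_on n C' \<and> circuit_size C' \<le> (2 * C + 2) * n \<and>
        (\<forall>x. length x = n \<longrightarrow>
           (x \<in> Yes \<longrightarrow> circuit_val A C' x) \<and> (x \<in> No \<longrightarrow> \<not> circuit_val A C' x))"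
      using n by (intro exI[of _ n] conjI exI[of _ "advice_circuit n w"] allI impI)
        (simp_all only: advice_circuit Suc_leD simp_thms)
  qed
  then show ?thesis using assms(1) unfolding io_SIZE_linear_def by blast
qed

section \<open>From probabilities to counts\<close>

lemma prob_coins: "\<P>(r in measure_pmf (coins l). Q r) = real (card {r \<in> strings l. Q r}) / 2 ^ l"
proof -
  have "replicate l True \<in> strings l" by simp
  then have "strings l \<noteq> {}" by blast
  then show ?thesis
    unfolding coins_def by (simp add: measure_pmf_of_set finite_strings card_strings Int_def)
qed

lemma cond_prob_coins:
  "\<P>(r in measure_pmf (coins l). P r \<bar> Q r)
     = real (card {r \<in> strings l. Q r \<and> P r}) / real (card {r \<in> strings l. Q r})"
  unfolding cond_prob_def prob_coins by (simp add: conj_commute)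

lemma two_thirds_fraction:
  assumes "0 < a + b"
  shows "2 / 3 \<le> real a / real (a + b) \<longleftrightarrow> 2 * b \<le> a" "real a / real (a + b) \<le> 1 / 3 \<longleftrightarrow> 2 * a \<le> b"
proof -
  have pos: "0 < real (a + b)" using assms by (simp only: of_nat_0_less_iff)
  show "2 / 3 \<le> real a / real (a + b) \<longleftrightarrow> 2 * b \<le> a"
    unfolding pos_le_divide_eq[OF pos] by auto
  show "real a / real (a + b) \<le> 1 / 3 \<longleftrightarrow> 2 * a \<le> b"
    unfolding pos_divide_le_eq[OF pos] by auto
qed

text \<open>Membership in the class promises halting for this very oracle, so clocked and unclocked
  acceptance agree. Among the seeds kept by \<open>B\<close>, those accepted and those rejected by
  \<open>D\<close> are complementary, which turns the thresholds into a factor of two.\<close>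

lemma post_decides_sound:
  assumes "(Yes, No) \<in> pr_PostBPE A"
  obtains p where "\<And>x. x \<in> Yes \<Longrightarrow> post_decides p (length x) x True A"
    "\<And>x. x \<in> No \<Longrightarrow> post_decides p (length x) x False A"
proof -
  obtain D B c d where
    halt: "\<And>x r. length r = exp_bound d (length x) \<Longrightarrow>
           halts_within A D [x, r] (exp_bound c (length x)) \<and>
           halts_within A B [x, r] (exp_bound c (length x))"
    and pos: "\<And>x. x \<in> Yes \<union> No \<Longrightarrow>
           \<P>(r in measure_pmf (coins (exp_bound d (length x))). accepts A B [x, r]) > 0"
    and yes: "\<And>x. x \<in> Yes \<Longrightarrow>
           \<P>(r in measure_pmf (coins (exp_bound d (length x))). accepts A D [x, r] \<bar> accepts A B [x, r]) \<ge> 2/3"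
    and no: "\<And>x. x \<in> No \<Longrightarrow>
           \<P>(r in measure_pmf (coins (exp_bound d (length x))). accepts A D [x, r] \<bar> accepts A B [x, r]) \<le> 1/3"
    using assms unfolding pr_PostBPE_def by blast
  define N where "N x = post_count D B (exp_bound c (length x)) (exp_bound d (length x)) x A" for x
  let ?S = "\<lambda>x. {r \<in> strings (exp_bound d (length x)). accepts A B [x, r]}"
  have N: "N x b = card {r \<in> strings (exp_bound d (length x)). accepts A B [x, r] \<and> accepts A D [x, r] = b}" for x b
  proof -
    have "accepts A M [x, r] \<longleftrightarrow> yields A M (exp_bound c (length x)) [x, r]"
      if "length r = exp_bound d (length x)" "M \<in> {B, D}" for M r
      using accepts_iff_exec[of A M "[x, r]"] halt[OF that(1)] that(2) unfolding yields_def by blast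
    then show ?thesis unfolding N_def post_count_def by (intro arg_cong[of _ _ card]) auto
  qed
  have sum: "card (?S x) = N x True + N x False" for x
    unfolding N by (subst card_Un_disjoint[symmetric])
      (auto intro: finite_subset[OF _ finite_strings] intro!: arg_cong[of _ _ card])
  have prob: "\<P>(r in measure_pmf (coins (exp_bound d (length x))). accepts A D [x, r] \<bar> accepts A B [x, r])
      = real (N x True) / real (N x True + N x False)" for x
    unfolding cond_prob_coins sum N by simp
  have gt: "0 < N x True + N x False" if "x \<in> Yes \<union> No" for x
    using pos[OF that] unfolding prob_coins sum by (intro Nat.gr0I) simp
  show thesis
  proof (rule that[of "(D, B, c, d)"])
    fix x assume x: "x \<in> Yes"
    have "2 * N x False \<le> N x True"
      using yes[OF x] two_thirds_fraction(1)[OF gt[of x]] x unfolding prob by blast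
    then show "post_decides (D, B, c, d) (length x) x True A"
      using gt[of x] x unfolding post_decides_def N_def by (auto simp: Let_def)
  next
    fix x assume x: "x \<in> No"
    have "2 * N x True \<le> N x False"
      using no[OF x] two_thirds_fraction(2)[OF gt[of x]] x unfolding prob by blast
    then show "post_decides (D, B, c, d) (length x) x False A"
      using gt[of x] x unfolding post_decides_def N_def by (auto simp: Let_def)
  qed
qed

lemma ma_decides_sound:
  assumes "(Yes, No) \<in> pr_MA_E A"
  obtains p where "\<And>x. x \<in> Yes \<Longrightarrow> ma_decides p (length x) x True A"
    "\<And>x. x \<in> No \<Longrightarrow> ma_decides p (length x) x False A"
proof -
  obtain V c d e where
    halt: "\<And>x \<pi> r. length \<pi> \<le> exp_bound e (length x) \<Longrightarrow> length r = exp_bound d (length x) \<Longrightarrow>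
           halts_within A V [x, \<pi>, r] (exp_bound c (length x))"
    and yes: "\<And>x. x \<in> Yes \<Longrightarrow> \<exists>\<pi>. length \<pi> \<le> exp_bound e (length x) \<and>
           \<P>(r in measure_pmf (coins (exp_bound d (length x))). accepts A V [x, \<pi>, r]) \<ge> 2/3"
    and no: "\<And>x \<pi>. x \<in> No \<Longrightarrow> length \<pi> \<le> exp_bound e (length x) \<Longrightarrow>
           \<P>(r in measure_pmf (coins (exp_bound d (length x))). accepts A V [x, \<pi>, r]) \<le> 1/3"
    using assms unfolding pr_MA_E_def by blast
  define N where "N x = ma_count V (exp_bound c (length x)) (exp_bound d (length x)) x A" for x
  have prob: "\<P>(r in measure_pmf (coins (exp_bound d (length x))). accepts A V [x, \<pi>, r])
      = real (N x \<pi>) / 2 ^ exp_bound d (length x)" if \<pi>: "length \<pi> \<le> exp_bound e (length x)" for x \<pi>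
  proof -
    have "accepts A V [x, \<pi>, r] \<longleftrightarrow> yields A V (exp_bound c (length x)) [x, \<pi>, r]"
      if "length r = exp_bound d (length x)" for r
      using accepts_iff_exec[OF halt[OF \<pi> that]] unfolding yields_def .
    then have "{r \<in> strings (exp_bound d (length x)). accepts A V [x, \<pi>, r]}
      = {r \<in> strings (exp_bound d (length x)). yields A V (exp_bound c (length x)) [x, \<pi>, r]}" by auto
    then show ?thesis unfolding prob_coins N_def ma_count_def by simp
  qed
  show thesis
  proof (rule that[of "(V, c, d, e)"])
    fix x assume "x \<in> Yes"
    from yes[OF this] obtain \<pi> where \<pi>: "length \<pi> \<le> exp_bound e (length x) \<and>
        \<P>(r in measure_pmf (coins (exp_bound d (length x))). accepts A V [x, \<pi>, r]) \<ge> 2/3" ..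
    then have \<pi>: "length \<pi> \<le> exp_bound e (length x)" "2/3 \<le> real (N x \<pi>) / 2 ^ exp_bound d (length x)"
      using prob[of \<pi> x] by (simp_all only:)
    have "real (2 * 2 ^ exp_bound d (length x)) \<le> real (3 * N x \<pi>)" using \<pi>(2) by (simp add: field_simps)
    then have "2 * 2 ^ exp_bound d (length x) \<le> 3 * N x \<pi>" by (simp only: of_nat_le_iff)
    then show "ma_decides (V, c, d, e) (length x) x True A"
      using \<pi>(1) unfolding ma_decides_def N_def by (auto simp: Let_def)
  next
    fix x assume x: "x \<in> No"
    have "3 * N x \<pi> \<le> 2 ^ exp_bound d (length x)" if "length \<pi> \<le> exp_bound e (length x)" for \<pi>
    proof -
      have "real (3 * N x \<pi>) \<le> real (2 ^ exp_bound d (length x))"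
        using no[OF x that] unfolding prob[OF that] by (simp add: field_simps)
      then show ?thesis by (simp only: of_nat_le_iff)
    qed
    then show "ma_decides (V, c, d, e) (length x) x False A"
      unfolding ma_decides_def N_def by (auto simp: Let_def)
  qed
qed

section \<open>One oracle for both classes\<close>

theorem theorem1p3:
  shows "\<exists>A :: bool_oracle. pr_PostBPE A \<subseteq> io_SIZE_linear A \<and> pr_MA_E A \<subseteq> io_SIZE_linear A"
proof -
  \<comment> \<open>Requirements of both kinds are put into a sum type, so that a single
    diagonalisation serves both classes.\<close>
  let ?good = "case_sum post_decides ma_decides"
  \<comment> \<open>Twice the clock is the length beyond which \<open>yields_cong\<close> ignores
    the oracle.\<close>
  define \<tau> where "\<tau> p n = (case p of Inl (_, _, c, _) \<Rightarrow> 2 * exp_bound c n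
      | Inr (_, c, _, _) \<Rightarrow> 2 * exp_bound c n)"
    for p :: "machine \<times> machine \<times> nat \<times> nat + machine \<times> nat \<times> nat \<times> nat" and n
  have "\<exists>A. \<forall>p. \<exists>C. \<exists>\<^sub>\<infinity>n. \<exists>w. length w = C * n - n \<and>
      (\<forall>x\<in>strings n. \<forall>b. ?good p n x b A \<longrightarrow> A (x @ w) = b)"
  proof (rule diagonal)
    fix p
    show "\<exists>C\<ge>1. \<exists>n0. \<forall>n\<ge>n0. \<forall>A. \<exists>A' w. (\<forall>b. length b \<noteq> C * n \<longrightarrow> A' b = A b) \<and>
      length w = C * n - n \<and> (\<forall>x\<in>strings n. \<forall>b. ?good p n x b A' \<longrightarrow> A' (x @ w) = b)"
      by (cases p) (simp_all only: sum.case post_planted ma_planted)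
  next
    fix p n x b and A A' :: bool_oracle
    assume eq: "\<And>y. length y \<le> \<tau> p n \<Longrightarrow> A y = A' y"
    show "?good p n x b A = ?good p n x b A'"
    proof (cases p)
      case (Inl p')
      obtain D B c d where p': "p' = (D, B, c, d)" by (cases p')
      have "yields A M (exp_bound c n) inputs = yields A' M (exp_bound c n) inputs" for M inputs
        using eq by (intro yields_cong) (simp add: \<tau>_def Inl p')
      then show ?thesis by (simp add: Inl p' post_decides_def post_count_def)
    next
      case (Inr p')
      obtain V c d e where p': "p' = (V, c, d, e)" by (cases p')
      have "yields A M (exp_bound c n) inputs = yields A' M (exp_bound c n) inputs" for M inputs
        using eq by (intro yields_cong) (simp add: \<tau>_def Inr p')
      then show ?thesis by (simp add: Inr p' ma_decides_def ma_count_def)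
    qed
  qed
  then obtain A where A: "\<And>p. \<exists>C. \<exists>\<^sub>\<infinity>n. \<exists>w. length w = C * n - n \<and>
      (\<forall>x\<in>strings n. \<forall>b. ?good p n x b A \<longrightarrow> A (x @ w) = b)" by blast
  have "(Yes, No) \<in> io_SIZE_linear A" if *: "(Yes, No) \<in> pr_PostBPE A" for Yes No
  proof -
    obtain p where p: "\<And>x. x \<in> Yes \<Longrightarrow> post_decides p (length x) x True A"
      "\<And>x. x \<in> No \<Longrightarrow> post_decides p (length x) x False A"
      using post_decides_sound[OF *] by blast
    obtain C where C: "\<exists>\<^sub>\<infinity>n. \<exists>w. length w = C * n - n \<and>
      (\<forall>x\<in>strings n. \<forall>b. post_decides p n x b A \<longrightarrow> A (x @ w) = b)"
      using A[of "Inl p"] by (auto simp only: sum.case)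
    have "Yes \<inter> No = {}" using * by (simp add: pr_PostBPE_def)
    then show ?thesis using C p by (rule io_SIZE_linearI)
  qed
  moreover have "(Yes, No) \<in> io_SIZE_linear A" if *: "(Yes, No) \<in> pr_MA_E A" for Yes No
  proof -
    obtain p where p: "\<And>x. x \<in> Yes \<Longrightarrow> ma_decides p (length x) x True A"
      "\<And>x. x \<in> No \<Longrightarrow> ma_decides p (length x) x False A"
      using ma_decides_sound[OF *] by blast
    obtain C where C: "\<exists>\<^sub>\<infinity>n. \<exists>w. length w = C * n - n \<and>
      (\<forall>x\<in>strings n. \<forall>b. ma_decides p n x b A \<longrightarrow> A (x @ w) = b)"
      using A[of "Inr p"] by (auto simp only: sum.case)
    have "Yes \<inter> No = {}" using * by (simp add: pr_MA_E_def)
    then show ?thesis using C p by (rule io_SIZE_linearI)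
  qed
  ultimately show ?thesis by (intro exI[of _ A] conjI subrelI)
qed

end
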